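(* Let $P$ be a graded poset of rank $n+1$, where $n\ge 0$. Then $$\Psi_{\widehat{I_2}(P)}(a,b)=\mathcal{I}_2(\Psi_P(a,b)),$$ where the linear operator $\mathcal{I}_2:\mathbb{Q}\langle a,b\rangle\to\mathbb{Q}\langle a,b\rangle$ is given on $ab$-words $u$ by the formula $$\mathcal{I}_2(u)=u+u^*+\sum_u M(u_{(1)}^*,u_{(2)}).$$
   Context: All posets are finite. A poset is graded if it has a unique minimum $\widehat{0}$, a unique maximum $\widehat{1}$ and a rank function $\rho$ with $\rho(\widehat 0)=0$ and $\rho(y)=\rho(x)+1$ whenever $y$ covers $x$; its rank is $\rho(\widehat 1)$. For a graded poset $P$ of rank $n+1$ and $S\subseteq\{1,\ldots,n\}$, $f_S(P)$ is the number of chains $x_1<\cdots<x_{|S|}$ in $P$ whose set of ranks is $S$. Put $\Upsilon_P(a,b)=\sum_S f_S(P)\,u_S$, where $u_S=u_1\cdots u_n$ is the monomial in noncommuting variables $a,b$ with $u_i=b$ if $i\in S$ and $u_i=a$ if $i\notin S$. The $ab$-index is $\Psi_P(a,b)=\Upsilon_P(a-b,b)$. $\widehat{I}(P)$ is the set of all intervals of $P$ together with the empty set, ordered by inclusion. The total $ab$-index is $$\Psi_{\widehat{I_2}(P)}(a,b)=\sum_{x\in P}\Psi_{[[x,x],[\widehat 0,\widehat 1]]}(a,b),$$ where $[[x,x],[\widehat 0,\widehat 1]]$ is the interval of $\widehat{I}(P)$ consisting of all intervals of $P$ that contain $x$, ordered by inclusion (a graded poset). $\mathbb{Q}\langle a,b\rangle$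 is the free associative algebra with basis all $ab$-words, including the empty word $1$. For an $ab$-word $u=u_1\cdots u_n$, $u^*=u_n\cdots u_1$. The coproduct $\Delta$ is the linear map with $\Delta(u)=\sum_{i=1}^n u_1\cdots u_{i-1}\otimes u_{i+1}\cdots u_n$ for an $ab$-word $u=u_1\cdots u_n$ (so $\Delta(1)=0$), written in Sweedler notation as $\Delta(u)=\sum_u u_{(1)}\otimes u_{(2)}$. The mixing operator $M$ is the bilinear operator on $\mathbb{Q}\langle a,b\rangle$ given by $$M(u,v)=\sum_{r=1}^2\sum_{s=1}^2\ \sum_{n\ge 2,\ n-r-s-1\text{ even}}M_{r,s,n}(u,v),$$ where the bilinear operators $M_{r,s,n}$ (needed only for $n-r-s-1$ even) are defined recursively by $M_{1,2,2}(u,v)=u\cdot a\cdot v$, $M_{2,1,2}(u,v)=v\cdot b\cdot u$, and for $n\ge 2$: $M_{1,s,n+1}(u,v)=\sum_u u_{(1)}\cdot a\cdot M_{2,s,n}(u_{(2)},v)$ and $M_{2,s,n+1}(u,v)=\sum_v v_{(1)}\cdot b\cdot M_{1,s,n}(u,v_{(2)})$. For given $u,v$ only finitely many terms are nonzero. *)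

theory Defs
  imports Complex_Main "HOL-Library.Poly_Mapping"
begin

section \<open>Graded posets\<close>

text \<open>A poset is a carrier set \<open>P\<close> with \<open>partial_order_on P r\<close>; \<open>(x, y) \<in> r\<close> means
  \<open>x \<le> y\<close>.\<close>

definition is_minimum :: "'a set \<Rightarrow> 'a rel \<Rightarrow> 'a \<Rightarrow> bool" where
  "is_minimum P r m \<longleftrightarrow> m \<in> P \<and> (\<forall>x\<in>P. (m, x) \<in> r)"

definition is_maximum :: "'a set \<Rightarrow> 'a rel \<Rightarrow> 'a \<Rightarrow> bool" where
  "is_maximum P r m \<longleftrightarrow> m \<in> P \<and> (\<forall>x\<in>P. (x, m) \<in> r)"

definition poset_bot :: "'a set \<Rightarrow> 'a rel \<Rightarrow> 'a" where
  "poset_bot P r = (THE m. is_minimum P r m)"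

definition poset_top :: "'a set \<Rightarrow> 'a rel \<Rightarrow> 'a" where
  "poset_top P r = (THE m. is_maximum P r m)"

definition less_in :: "'a rel \<Rightarrow> 'a \<Rightarrow> 'a \<Rightarrow> bool" where
  "less_in r x y \<longleftrightarrow> (x, y) \<in> r \<and> x \<noteq> y"

text \<open>\<open>y\<close> covers \<open>x\<close>.\<close>
definition covers :: "'a set \<Rightarrow> 'a rel \<Rightarrow> 'a \<Rightarrow> 'a \<Rightarrow> bool" where
  "covers P r y x \<longleftrightarrow> x \<in> P \<and> y \<in> P \<and> less_in r x y \<and>
     \<not> (\<exists>z\<in>P. less_in r x z \<and> less_in r z y)"

definition is_rank_function :: "'a set \<Rightarrow> 'a rel \<Rightarrow> ('a \<Rightarrow> nat) \<Rightarrow> bool" where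
  "is_rank_function P r \<rho> \<longleftrightarrow> \<rho> (poset_bot P r) = 0 \<and>
     (\<forall>x y. covers P r y x \<longrightarrow> \<rho> y = \<rho> x + 1)"

definition graded_poset :: "'a set \<Rightarrow> 'a rel \<Rightarrow> bool" where
  "graded_poset P r \<longleftrightarrow> finite P \<and> partial_order_on P r \<and>
     (\<exists>m. is_minimum P r m) \<and> (\<exists>m. is_maximum P r m) \<and> (\<exists>\<rho>. is_rank_function P r \<rho>)"

text \<open>On the carrier of a graded poset the rank function is unique, so the choice below only
  affects irrelevant values outside \<open>P\<close>.\<close>
definition rank_fun :: "'a set \<Rightarrow> 'a rel \<Rightarrow> 'a \<Rightarrow> nat" where
  "rank_fun P r = (SOME \<rho>. is_rank_function P r \<rho>)"

definition poset_rank :: "'a set \<Rightarrow> 'a rel \<Rightarrow> nat" where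
  "poset_rank P r = rank_fun P r (poset_top P r)"

definition interval :: "'a set \<Rightarrow> 'a rel \<Rightarrow> 'a \<Rightarrow> 'a \<Rightarrow> 'a set" where
  "interval P r x y = {z \<in> P. (x, z) \<in> r \<and> (z, y) \<in> r}"

text \<open>The set of all intervals together with the empty set; it is ordered by
  \<open>relation_of (\<subseteq>)\<close>.\<close>
definition interval_poset :: "'a set \<Rightarrow> 'a rel \<Rightarrow> 'a set set" where
  "interval_poset P r = insert {} {interval P r x y |x y. x \<in> P \<and> y \<in> P \<and> (x, y) \<in> r}"

text \<open>A chain \<open>x\<^sub>1 < \<dots> < x\<^sub>k\<close> is encoded by its set of elements.\<close>
definition flag_f :: "'a set \<Rightarrow> 'a rel \<Rightarrow> nat set \<Rightarrow> nat" where
  "flag_f P r S =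
     card {C. C \<subseteq> P \<and> C \<in> Chains r \<and> card C = card S \<and> rank_fun P r ` C = S}"


section \<open>The free associative algebra on two letters\<close>

datatype letter = LetterA | LetterB

text \<open>Words form a monoid under concatenation. With this instance, the multiplication of
  \<open>Poly_Mapping\<close> on finitely supported functions is that of the monoid algebra.\<close>

instantiation list :: (type) monoid_add
begin

definition zero_list :: "'a list" where
  "0 = []"

definition plus_list :: "'a list \<Rightarrow> 'a list \<Rightarrow> 'a list" where
  "xs + ys = xs @ ys"

instance
  by standard (simp_all add: zero_list_def plus_list_def)

end

type_synonym word = "letter list"

type_synonym ab_alg = "word \<Rightarrow>\<^sub>0 rat"

definition mon :: "word \<Rightarrow> ab_alg" where
  "mon w = Poly_Mapping.single w 1"

definition var_a :: ab_alg where
  "var_a = mon [LetterA]"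

definition var_b :: ab_alg where
  "var_b = mon [LetterB]"

lemma mon_Nil: "mon [] = 1"
  by (simp add: mon_def single_one[symmetric] zero_list_def)

lemma mon_append: "mon (u @ v) = mon u * mon v"
  by (simp add: mon_def mult_single plus_list_def)

text \<open>The linear map from the free rational vector space on the basis \<open>'b\<close> that has prescribed
  values on the basis. Multiplication by \<open>single 0 c\<close> is scalar multiplication by \<open>c\<close>.\<close>
definition lin_ext :: "('b \<Rightarrow> ab_alg) \<Rightarrow> ('b \<Rightarrow>\<^sub>0 rat) \<Rightarrow> ab_alg" where
  "lin_ext f p =
     (\<Sum>k\<in>Poly_Mapping.keys p. Poly_Mapping.single 0 (Poly_Mapping.lookup p k) * f k)"

definition word_star :: "ab_alg \<Rightarrow> ab_alg" where
  "word_star = lin_ext (\<lambda>u. mon (rev u))"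

text \<open>The tensor square is the free vector space on pairs of words. \<open>coprod_word u\<close> is the
  coproduct of a single word; positions are counted from \<open>0\<close>.\<close>
definition coprod_word :: "word \<Rightarrow> (word \<times> word) \<Rightarrow>\<^sub>0 rat" where
  "coprod_word u = (\<Sum>i<length u. Poly_Mapping.single (take i u, drop (Suc i) u) 1)"

text \<open>For a bilinear \<open>B\<close>, \<open>sweedler B p\<close> is the sum of \<open>B p\<^sub>(\<^sub>1\<^sub>) p\<^sub>(\<^sub>2\<^sub>)\<close> in Sweedler notation:
  the linear map induced by \<open>B\<close> on the tensor square, applied to the coproduct of \<open>p\<close>.\<close>
definition sweedler :: "(ab_alg \<Rightarrow> ab_alg \<Rightarrow> ab_alg) \<Rightarrow> ab_alg \<Rightarrow> ab_alg" where
  "sweedler B = lin_ext (\<lambda>u. lin_ext (\<lambda>(x, y). B (mon x) (mon y)) (coprod_word u))"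


section \<open>The mixing operator\<close>

text \<open>\<open>mix_op r s n\<close> is meaningful for \<open>r, s \<in> {1, 2}\<close>, \<open>n \<ge> 2\<close> and \<open>n - r - s - 1\<close> even;
  it is \<open>0\<close> where the recursion leaves it unspecified.\<close>
fun mix_op :: "nat \<Rightarrow> nat \<Rightarrow> nat \<Rightarrow> ab_alg \<Rightarrow> ab_alg \<Rightarrow> ab_alg" where
  "mix_op r s 0 u v = 0"
| "mix_op r s (Suc n) u v =
    (if Suc n = 2 then
       (if r = 1 \<and> s = 2 then u * var_a * v
        else if r = 2 \<and> s = 1 then v * var_b * u
        else 0)
     else if n \<ge> 2 \<and> r = 1 then sweedler (\<lambda>u1 u2. u1 * var_a * mix_op 2 s n u2 v) u
     else if n \<ge> 2 \<and> r = 2 then sweedler (\<lambda>v1 v2. v1 * var_b * mix_op 1 s n u v2) v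
     else 0)"

lemma mix_op_base:
  "mix_op 1 2 2 u v = u * var_a * v"
  "mix_op 2 1 2 u v = v * var_b * u"
  by (simp_all add: numeral_2_eq_2)

lemma mix_op_step:
  assumes "n \<ge> 2"
  shows "mix_op 1 s (n + 1) u v = sweedler (\<lambda>u1 u2. u1 * var_a * mix_op 2 s n u2 v) u"
    and "mix_op 2 s (n + 1) u v = sweedler (\<lambda>v1 v2. v1 * var_b * mix_op 1 s n u v2) v"
  using assms by simp_all

definition mixing :: "ab_alg \<Rightarrow> ab_alg \<Rightarrow> ab_alg" where
  "mixing u v =
     (\<Sum>r\<in>{1,2}. \<Sum>s\<in>{1,2}.
        Sum_any (\<lambda>n. if n \<ge> 2 \<and> even (int n - int r - int s - 1) then mix_op r s n u v else 0))"

text \<open>\<open>Sum_any\<close> is \<open>0\<close> on infinite supports; the next two lemmas show that this case does not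
  occur in \<open>mixing\<close>.\<close>

lemma mix_op_eq_0:
  assumes "\<And>w. w \<in> Poly_Mapping.keys u \<Longrightarrow> length w \<le> d"
    and "\<And>w. w \<in> Poly_Mapping.keys v \<Longrightarrow> length w \<le> e"
    and "n > d + e + 2"
  shows "mix_op r s n u v = 0"
  using assms
proof (induction n arbitrary: r u v d e)
  case 0
  then show ?case by simp
next
  case (Suc n)
  have sweedler_0: "sweedler B p = 0"
    if len: "\<And>w. w \<in> Poly_Mapping.keys p \<Longrightarrow> length w \<le> k"
      and B: "\<And>x y. k > 0 \<Longrightarrow> length y \<le> k - 1 \<Longrightarrow> B (mon x) (mon y) = 0" for B p k
  proof -
    have "B (mon x) (mon y) = 0"
      if w: "w \<in> Poly_Mapping.keys p" and xy: "(x, y) \<in> Poly_Mapping.keys (coprod_word w)"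
      for w x y
    proof -
      have "Poly_Mapping.keys (coprod_word w)
          \<subseteq> (\<Union>i<length w. Poly_Mapping.keys
              (Poly_Mapping.single (take i w, drop (Suc i) w) (1::rat)))"
        unfolding coprod_word_def by (rule keys_sum)
      with xy obtain i where "i < length w" "y = drop (Suc i) w"
        by auto
      with len[OF w] have "k > 0" "length y \<le> k - 1" by auto
      then show ?thesis by (rule B)
    qed
    then show ?thesis
      unfolding sweedler_def lin_ext_def
      by (intro sum.neutral ballI) (auto intro!: sum.neutral simp: case_prod_beta)
  qed
  have keys_mon: "length w \<le> k" if "w \<in> Poly_Mapping.keys (mon y)" "length y \<le> k" for w y k
    using that by (simp add: mon_def)
  have n2: "n \<ge> 2" using Suc.prems(3) by simp
  have "sweedler (\<lambda>u1 u2. u1 * var_a * mix_op 2 s n u2 v) u = 0"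
  proof (rule sweedler_0[OF Suc.prems(1)])
    fix x y :: word assume "d > 0" "length y \<le> d - 1"
    then have "mix_op 2 s n (mon y) v = 0"
      using Suc.prems(3) keys_mon
      by (intro Suc.IH[of _ "d - 1" _ e] Suc.prems(2)) auto
    then show "mon x * var_a * mix_op 2 s n (mon y) v = 0" by simp
  qed
  moreover have "sweedler (\<lambda>v1 v2. v1 * var_b * mix_op 1 s n u v2) v = 0"
  proof (rule sweedler_0[OF Suc.prems(2)])
    fix x y :: word assume "e > 0" "length y \<le> e - 1"
    then have "mix_op 1 s n u (mon y) = 0"
      using Suc.prems(3) keys_mon
      by (intro Suc.IH[of _ d _ "e - 1"] Suc.prems(1)) auto
    then show "mon x * var_b * mix_op 1 s n u (mon y) = 0" by simp
  qed
  ultimately show ?case using n2 by simp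
qed

lemma finite_mix_op_support:
  "finite {n. (if n \<ge> 2 \<and> even (int n - int r - int s - 1) then mix_op r s n u v else 0) \<noteq> 0}"
proof -
  have bound: "length w \<le> Max (insert 0 (length ` Poly_Mapping.keys p))"
    if "w \<in> Poly_Mapping.keys p" for w :: word and p :: ab_alg
    using that by (intro Max_ge) auto
  define N where "N = Max (insert 0 (length ` Poly_Mapping.keys u))
    + Max (insert 0 (length ` Poly_Mapping.keys v)) + 2"
  have zero: "mix_op r s n u v = 0" if "n > N" for n
    by (rule mix_op_eq_0[OF bound bound]) (use that in \<open>auto simp: N_def\<close>)
  have "{n. (if n \<ge> 2 \<and> even (int n - int r - int s - 1) then mix_op r s n u v else 0) \<noteq> 0}
      \<subseteq> {n. \<not> n > N}"
    by (intro Collect_mono impI notI) (simp only: zero if_cancel not_True_eq_False simp_thms)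
  then show ?thesis
    by (rule finite_subset) (simp add: not_less)
qed

definition I2 :: "ab_alg \<Rightarrow> ab_alg" where
  "I2 = lin_ext (\<lambda>u. mon u + mon (rev u)
          + sweedler (\<lambda>u1 u2. mixing (word_star u1) u2) (mon u))"


section \<open>The ab-index\<close>

text \<open>The noncommutative polynomial \<open>\<Upsilon>\<^sub>P\<close> of a graded poset \<open>P\<close> of rank \<open>n + 1\<close>, evaluated at
  two elements of the algebra.\<close>
definition Upsilon :: "'a set \<Rightarrow> 'a rel \<Rightarrow> ab_alg \<Rightarrow> ab_alg \<Rightarrow> ab_alg" where
  "Upsilon P r x y =
     (let n = poset_rank P r - 1 in
      \<Sum>S\<in>Pow {1..n}. of_nat (flag_f P r S) *
        prod_list (map (\<lambda>i. if i \<in> S then y else x) [1..<n + 1]))"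

definition ab_index :: "'a set \<Rightarrow> 'a rel \<Rightarrow> ab_alg" where
  "ab_index P r = Upsilon P r (var_a - var_b) var_b"

text \<open>The interval \<open>[[x, x], [0, 1]]\<close> of the interval poset.\<close>
definition intervals_containing :: "'a set \<Rightarrow> 'a rel \<Rightarrow> 'a \<Rightarrow> 'a set set" where
  "intervals_containing P r x =
     interval (interval_poset P r) (relation_of (\<subseteq>) (interval_poset P r))
       (interval P r x x) (interval P r (poset_bot P r) (poset_top P r))"

definition total_ab_index :: "'a set \<Rightarrow> 'a rel \<Rightarrow> ab_alg" where
  "total_ab_index P r =
     (\<Sum>x\<in>P. ab_index (intervals_containing P r x)
                (relation_of (\<subseteq>) (intervals_containing P r x)))"

end

(* Put e = a - b. The ab-index psi(x,y) of an interval sums words over chains, so in the incidence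
   algebra psi = kappa + kappa b psi, where kappa(x,y) = e^(rank(x,y) - 1) for x < y. Since e^k is
   annihilated by the coproduct, which is a derivation, Delta psi(x,y) is the sum over x < z < y of
   psi(x,z) (x) psi(z,y).

   The interval [[x,x],[0,1]] is the product of the dual of [0,x] with [x,1], so it suffices that M
   computes the ab-index of a product. Let U and V be the psi of the two factors. By the coproduct
   formula M sums the alternating products U a V b U ... and V b U a V ...; call the two sums X and
   Y, so X = U + U a Y and Y = V + V b X. With Z = 1 + b (X + Y), multiplying by 1 - kappa_1 b and
   1 - kappa_2 b gives X = kappa_1 (Z + e Y) and Y = kappa_2 Z, hence
   X + Y = (kappa_1 + kappa_2 + kappa_1 e kappa_2) Z, and the bracket is the kappa of the product. *)

theory Submission
  imports Defs
begin

section \<open>Linear and bilinear maps on the free algebra\<close>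

definition qlinear :: "(ab_alg \<Rightarrow> ab_alg) \<Rightarrow> bool" where
  "qlinear f \<longleftrightarrow> (\<forall>p q. f (p + q) = f p + f q) \<and>
     (\<forall>c p. f (Poly_Mapping.single 0 c * p) = Poly_Mapping.single 0 c * f p)"

definition qbilinear :: "(ab_alg \<Rightarrow> ab_alg \<Rightarrow> ab_alg) \<Rightarrow> bool" where
  "qbilinear B \<longleftrightarrow> (\<forall>v. qlinear (\<lambda>u. B u v)) \<and> (\<forall>u. qlinear (B u))"

lemma poly_mapping_expansion:
  fixes p :: "'b \<Rightarrow>\<^sub>0 'c::comm_monoid_add"
  shows "p = (\<Sum>k\<in>Poly_Mapping.keys p. Poly_Mapping.single k (Poly_Mapping.lookup p k))"
  by (rule poly_mapping_eqI)
    (auto simp: lookup_sum lookup_single when_def in_keys_iff sum.delta)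

lemma mon_expansion:
  "p = (\<Sum>k\<in>Poly_Mapping.keys p. Poly_Mapping.single 0 (Poly_Mapping.lookup p k) * mon k)"
  by (subst poly_mapping_expansion) (simp add: mon_def mult_single zero_list_def plus_list_def)

text \<open>The empty word commutes with every word, so scalars are central in this noncommutative
  algebra. Linearity of left multiplication rests on this.\<close>

lemma scalar_commute:
  fixes p :: ab_alg
  shows "p * Poly_Mapping.single 0 c = Poly_Mapping.single 0 c * p"
proof -
  have "(\<Sum>k\<in>K. Poly_Mapping.single k (g k)) * Poly_Mapping.single 0 c =
      Poly_Mapping.single 0 c * (\<Sum>k\<in>K. Poly_Mapping.single k (g k))"
    for K :: "word set" and g :: "word \<Rightarrow> rat"
    by (simp add: sum_distrib_left sum_distrib_right mult_single mult.commute)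
  from this[of "Poly_Mapping.lookup p" "Poly_Mapping.keys p"] show ?thesis
    by (simp flip: poly_mapping_expansion)
qed

lemma scalar_left_commute:
  fixes p q :: ab_alg
  shows "p * (Poly_Mapping.single 0 c * q) = Poly_Mapping.single 0 c * (p * q)"
  by (metis mult.assoc scalar_commute)

lemma qlinear_add: "qlinear f \<Longrightarrow> f (p + q) = f p + f q"
  and qlinear_scale: "qlinear f \<Longrightarrow>
    f (Poly_Mapping.single 0 c * p) = Poly_Mapping.single 0 c * f p"
  by (simp_all add: qlinear_def)

lemma qlinear_0: "qlinear f \<Longrightarrow> f 0 = 0"
  using qlinear_add[of f 0 0] by simp

lemma qlinear_minus: "qlinear f \<Longrightarrow> f (p - q) = f p - f q"
  using qlinear_add[of f "p - q" q] by (simp add: algebra_simps)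

lemma qlinear_sum: "qlinear f \<Longrightarrow> f (sum g A) = (\<Sum>i\<in>A. f (g i))"
  by (induction A rule: infinite_finite_induct) (simp_all add: qlinear_0 qlinear_add)

text \<open>The words span the algebra by \<open>mon_expansion\<close>; identities between linear
  maps are therefore checked on single words.\<close>

lemma qlinear_eqI:
  assumes "qlinear f" "qlinear g" "\<And>w. f (mon w) = g (mon w)"
  shows "f p = g p"
proof -
  have "f (\<Sum>k\<in>K. Poly_Mapping.single 0 (h k) * mon k) =
      g (\<Sum>k\<in>K. Poly_Mapping.single 0 (h k) * mon k)" for K h
    by (simp add: qlinear_sum qlinear_scale assms)
  from this[of "Poly_Mapping.lookup p" "Poly_Mapping.keys p"] show ?thesis
    by (simp flip: mon_expansion)
qed

lemma qlinear_id: "qlinear (\<lambda>p. p)"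
  and qlinear_zero: "qlinear (\<lambda>p. 0)"
  by (simp_all add: qlinear_def)

lemma qlinear_plus: "qlinear f \<Longrightarrow> qlinear g \<Longrightarrow> qlinear (\<lambda>p. f p + g p)"
  by (simp add: qlinear_def algebra_simps)

lemma qlinear_if: "qlinear f \<Longrightarrow> qlinear g \<Longrightarrow> qlinear (\<lambda>p. if b then f p else g p)"
  by (cases b) simp_all

lemma qlinear_pointwise_sum: "(\<And>i. i \<in> A \<Longrightarrow> qlinear (f i)) \<Longrightarrow> qlinear (\<lambda>p. \<Sum>i\<in>A. f i p)"
  by (induction A rule: infinite_finite_induct) (simp_all add: qlinear_plus qlinear_zero)

text \<open>Finite supports are essential: \<open>Sum_any\<close> is 0 on infinite ones and would
  not be additive.\<close>

lemma qlinear_Sum_any: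
  assumes "\<And>n. qlinear (f n)" "\<And>p. finite {n. f n p \<noteq> 0}"
  shows "qlinear (\<lambda>p. Sum_any (\<lambda>n. f n p))"
  unfolding qlinear_def
  using assms by (auto simp: qlinear_add qlinear_scale Sum_any.distrib Sum_any_right_distrib)

lemma qlinear_mult_right: "qlinear f \<Longrightarrow> qlinear (\<lambda>p. f p * q)"
  by (simp add: qlinear_def algebra_simps)

lemma qlinear_mult_left: "qlinear f \<Longrightarrow> qlinear (\<lambda>p. q * f p)"
  by (simp add: qlinear_def algebra_simps scalar_left_commute)

lemma qlinear_compose: "qlinear f \<Longrightarrow> qlinear g \<Longrightarrow> qlinear (\<lambda>p. f (g p))"
  by (simp add: qlinear_def)

lemma qbilinearD1: "qbilinear B \<Longrightarrow> qlinear f \<Longrightarrow> qlinear (\<lambda>u. B (f u) v)"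
  by (simp add: qbilinear_def qlinear_compose[of "\<lambda>u. B u v"])

lemma qbilinearD2: "qbilinear B \<Longrightarrow> qlinear f \<Longrightarrow> qlinear (\<lambda>v. B u (f v))"
  by (simp add: qbilinear_def qlinear_compose[of "B u"])

lemma qbilinear_compose:
  "qbilinear B \<Longrightarrow> qlinear f \<Longrightarrow> qlinear g \<Longrightarrow> qbilinear (\<lambda>u v. B (f u) (g v))"
  by (simp add: qbilinear_def qlinear_compose[of "\<lambda>u. B u v" for v] qlinear_compose[of "B u" for u])

lemma qbilinear_eqI:
  assumes "qbilinear B" "qbilinear C" "\<And>w z. B (mon w) (mon z) = C (mon w) (mon z)"
  shows "B u v = C u v"
proof (rule qlinear_eqI[of "\<lambda>u. B u v" "\<lambda>u. C u v"])
  fix w show "B (mon w) v = C (mon w) v"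
    by (rule qlinear_eqI) (use assms in \<open>auto simp: qbilinear_def\<close>)
qed (use assms in \<open>auto simp: qbilinear_def\<close>)

section \<open>Linear extension from a basis\<close>

lemma lin_ext_superset:
  "finite A \<Longrightarrow> Poly_Mapping.keys p \<subseteq> A \<Longrightarrow>
    lin_ext f p = (\<Sum>k\<in>A. Poly_Mapping.single 0 (Poly_Mapping.lookup p k) * f k)"
  unfolding lin_ext_def by (rule sum.mono_neutral_left) (auto simp: in_keys_iff)

lemma lin_ext_add: "lin_ext f (p + q) = lin_ext f p + lin_ext f q"
proof -
  \<comment> \<open>Cancellation can remove keys from \<open>p + q\<close>, so all three sums are
    taken over a common index set.\<close>
  let ?A = "Poly_Mapping.keys p \<union> Poly_Mapping.keys q"
  have "Poly_Mapping.keys (p + q) \<subseteq> ?A" by (rule keys_add)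
  then show ?thesis
    by (simp add: lin_ext_superset[of ?A] lookup_add single_add distrib_right sum.distrib)
qed

lemma lin_ext_sum: "lin_ext f (sum g A) = (\<Sum>i\<in>A. lin_ext f (g i))"
  by (induction A rule: infinite_finite_induct)
    (simp_all add: lin_ext_add, simp_all add: lin_ext_def)

lemma lin_ext_single: "lin_ext f (Poly_Mapping.single k 1) = f k"
  by (simp add: lin_ext_def single_one)

lemma lin_ext_mon: "lin_ext f (mon w) = f w"
  by (simp add: mon_def lin_ext_single)

lemma lookup_scale:
  "Poly_Mapping.lookup (Poly_Mapping.single 0 c * p :: ab_alg) w = c * Poly_Mapping.lookup p w"
  by (simp flip: mult_map_scale_conv_mult add: map.rep_eq when_def)

lemma qlinear_lin_ext: "qlinear (lin_ext f)"
  unfolding qlinear_def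
proof (intro conjI allI)
  fix c and p :: ab_alg
  have "Poly_Mapping.keys (Poly_Mapping.single 0 c * p) \<subseteq> Poly_Mapping.keys p"
    by (auto simp: in_keys_iff lookup_scale)
  then show "lin_ext f (Poly_Mapping.single 0 c * p) = Poly_Mapping.single 0 c * lin_ext f p"
    by (simp add: lin_ext_superset[of "Poly_Mapping.keys p"] lookup_scale sum_distrib_left
        mult_single flip: mult.assoc)
qed (rule lin_ext_add)

lemma qlinear_lin_ext_values:
  assumes "\<And>k. qlinear (f k)"
  shows "qlinear (\<lambda>v. lin_ext (\<lambda>k. f k v) p)"
  unfolding lin_ext_def by (intro qlinear_pointwise_sum qlinear_mult_left assms)


section \<open>The coproduct and the reversal\<close>

lemma qlinear_sweedler: "qlinear (sweedler B)"
  unfolding sweedler_def by (rule qlinear_lin_ext)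

lemma sweedler_mon:
  "sweedler B (mon w) = (\<Sum>i<length w. B (mon (take i w)) (mon (drop (Suc i) w)))"
  by (simp add: sweedler_def lin_ext_mon coprod_word_def lin_ext_sum lin_ext_single)

lemma qlinear_sweedler_values:
  assumes "\<And>x y. qlinear (\<lambda>v. B v x y)"
  shows "qlinear (\<lambda>v. sweedler (B v) p)"
  unfolding sweedler_def by (intro qlinear_lin_ext_values) (auto intro: assms)

lemma sum_lessThan_add:
  fixes f :: "nat \<Rightarrow> 'b::comm_monoid_add"
  shows "(\<Sum>i<m + n. f i) = (\<Sum>i<m. f i) + (\<Sum>i<n. f (m + i))"
  by (induction n) (simp_all add: add.assoc)

text \<open>The coproduct is a derivation: a letter deleted from a product of words lies in one of
  the two factors. On words this splits the sum over positions at \<open>length u\<close>.\<close>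

lemma sweedler_mult:
  assumes B: "qbilinear B"
  shows "sweedler B (p * q) =
    sweedler (\<lambda>x y. B x (y * q)) p + sweedler (\<lambda>x y. B (p * x) y) q"
proof (rule qbilinear_eqI[of "\<lambda>p q. sweedler B (p * q)"])
  note intros = qlinear_plus qlinear_sweedler qlinear_sweedler_values
    qbilinearD1[OF B] qbilinearD2[OF B] qlinear_mult_left qlinear_mult_right qlinear_id
  show "qbilinear (\<lambda>p q. sweedler B (p * q))"
    unfolding qbilinear_def
    by (intro conjI allI; rule qlinear_compose[OF qlinear_sweedler];
        intro qlinear_mult_left qlinear_mult_right qlinear_id)
  show "qbilinear (\<lambda>p q. sweedler (\<lambda>x y. B x (y * q)) p + sweedler (\<lambda>x y. B (p * x) y) q)"
    unfolding qbilinear_def by (intro conjI allI; (rule intros)+)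
  fix u v :: word
  have "sweedler B (mon (u @ v)) =
      (\<Sum>i<length u. B (mon (take i (u @ v))) (mon (drop (Suc i) (u @ v)))) +
      (\<Sum>i<length v. B (mon (take (length u + i) (u @ v)))
        (mon (drop (Suc (length u + i)) (u @ v))))"
    by (simp only: sweedler_mon length_append sum_lessThan_add)
  then show "sweedler B (mon u * mon v) = sweedler (\<lambda>x y. B x (y * mon v)) (mon u)
      + sweedler (\<lambda>x y. B (mon u * x) y) (mon v)"
    by (simp add: sweedler_mon flip: mon_append)
qed

lemma sweedler_var: "sweedler B var_a = B 1 1" "sweedler B var_b = B 1 1"
  by (simp_all add: var_a_def var_b_def sweedler_mon mon_Nil)

lemma sweedler_1: "sweedler B 1 = 0"
  using sweedler_mon[of B "[]"] by (simp add: mon_Nil)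

definition var_e :: ab_alg where "var_e = var_a - var_b"

text \<open>Both letters have coproduct 1 tensor 1, so that of \<open>var_e\<close> vanishes. The
  induction needs \<open>B\<close> arbitrary because the derivation rule moves a factor
  \<open>var_e\<close> into its first argument.\<close>

lemma sweedler_var_e_power: "qbilinear B \<Longrightarrow> sweedler B (var_e ^ k) = 0"
proof (induction k arbitrary: B)
  case 0
  then show ?case by (simp add: sweedler_1)
next
  case (Suc k)
  have "sweedler (\<lambda>x y. B (var_e * x) y) (var_e ^ k) = 0"
    by (intro Suc.IH qbilinear_compose[OF Suc.prems, of "\<lambda>x. var_e * x" "\<lambda>x. x"]
        qlinear_mult_left qlinear_id)
  moreover have "sweedler C var_e = 0" for C
    by (simp add: var_e_def qlinear_minus[OF qlinear_sweedler] sweedler_var)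
  ultimately show ?case
    by (simp add: sweedler_mult[OF Suc.prems])
qed

section \<open>Reversal as an anti-automorphism\<close>

lemma qlinear_word_star: "qlinear word_star"
  unfolding word_star_def by (rule qlinear_lin_ext)

lemma word_star_mon: "word_star (mon w) = mon (rev w)"
  by (simp add: word_star_def lin_ext_mon)

lemma word_star_mult: "word_star (p * q) = word_star q * word_star p"
proof (rule qbilinear_eqI[of "\<lambda>p q. word_star (p * q)" "\<lambda>p q. word_star q * word_star p"])
  show "qbilinear (\<lambda>p q. word_star (p * q))" "qbilinear (\<lambda>p q. word_star q * word_star p)"
    unfolding qbilinear_def
    by (intro conjI allI;
        (rule qlinear_compose[OF qlinear_word_star] qlinear_word_star
          qlinear_mult_left qlinear_mult_right qlinear_id)+)+
  show "word_star (mon u * mon v) = word_star (mon v) * word_star (mon u)" for u v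
    by (simp add: word_star_mon flip: mon_append)
qed

lemma word_star_prod_list: "word_star (prod_list xs) = prod_list (rev (map word_star xs))"
  using word_star_mon[of "[]"] by (induction xs) (simp_all add: word_star_mult mon_Nil)

lemma word_star_var: "word_star var_e = var_e" "word_star var_b = var_b"
  by (simp_all add: var_e_def qlinear_minus[OF qlinear_word_star] var_a_def var_b_def word_star_mon)


section \<open>The mixing operator\<close>

lemma qbilinear_mix_op: "qbilinear (mix_op r s n)"
proof (induction n arbitrary: r)
  case 0
  then show ?case by (simp add: qbilinear_def qlinear_zero)
next
  case (Suc n)
  note intros = qlinear_if qlinear_sweedler qlinear_sweedler_values qlinear_zero
    qbilinearD1[OF Suc.IH] qbilinearD2[OF Suc.IH] qlinear_mult_left qlinear_mult_right qlinear_id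
  show ?case
    unfolding qbilinear_def mix_op.simps by (intro conjI allI; (rule intros)+)
qed

text \<open>A step of the recursion lowers \<open>n\<close> by one and exchanges the values 1 and 2
  of \<open>r\<close>, which preserves the parity of \<open>n - r - s - 1\<close>. At
  \<open>n = 2\<close> only \<open>r \<noteq> s\<close> is nonzero, and there the parity is
  even.\<close>

lemma mix_op_parity:
  "r \<in> {1, 2} \<Longrightarrow> s \<in> {1, 2} \<Longrightarrow> odd (int n - int r - int s - 1) \<Longrightarrow> mix_op r s n u v = 0"
proof (induction n arbitrary: r u v)
  case 0
  then show ?case by simp
next
  case (Suc n)
  \<comment> \<open>\<open>3 - r\<close> exchanges 1 and 2.\<close>
  have IH: "mix_op (3 - r) s n u v = 0" for u v
    using Suc.prems by (intro Suc.IH) auto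
  have zero: "sweedler (\<lambda>_ _. 0) p = 0" for p
    using qlinear_0[OF qlinear_sweedler_values[of "\<lambda>v x y. v", OF qlinear_id]] .
  from Suc.prems(1,2) consider "n = 1" "r = s" | "n = 1" "r \<noteq> s" | "n \<noteq> 1" "r = 1" | "n \<noteq> 1" "r = 2"
    by blast
  then show ?case
  proof cases
    case 2
    then have "int (Suc n) - int r - int s - 1 = - 2"
      using Suc.prems(1,2) by auto
    then show ?thesis using Suc.prems(3) by simp
  next
    case 3
    with IH have "mix_op 2 s n u v = 0" for u v by simp
    with 3 show ?thesis by (simp add: zero)
  next
    case 4
    with IH have "mix_op 1 s n u v = 0" for u v by simp
    with 4 show ?thesis by (simp add: zero)
  qed auto
qed

text \<open>The part of \<open>mixing\<close> whose words start with a piece of \<open>u\<close>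
  (\<open>r = 1\<close>) or of \<open>v\<close> (\<open>r = 2\<close>). Summed over \<open>s\<close>
  and \<open>n\<close>, the recursion of \<open>mix_op\<close> becomes two mutually recursive
  equations.\<close>

definition mixing_from :: "nat \<Rightarrow> ab_alg \<Rightarrow> ab_alg \<Rightarrow> ab_alg" where
  "mixing_from r u v = (\<Sum>s\<in>{1,2}.
     Sum_any (\<lambda>n. if n \<ge> 2 \<and> even (int n - int r - int s - 1) then mix_op r s n u v else 0))"

lemma mixing_eq: "mixing u v = mixing_from 1 u v + mixing_from 2 u v"
  by (simp add: mixing_def mixing_from_def)

lemma qbilinear_mixing_from: "qbilinear (mixing_from r)"
  unfolding qbilinear_def mixing_from_def
  by (intro conjI allI qlinear_pointwise_sum qlinear_Sum_any finite_mix_op_support qlinear_if qlinear_zero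
      qbilinearD1[OF qbilinear_mix_op] qbilinearD2[OF qbilinear_mix_op] qlinear_id)

text \<open>Beyond \<open>n = N + 2\<close> everything vanishes by \<open>mix_op_eq_0\<close>, and
  summands of the wrong parity are 0 by \<open>mix_op_parity\<close>. \<open>N\<close> is any bound,
  so that a word and its shorter pieces can share one range.\<close>

lemma mixing_from_mon:
  assumes "r \<in> {1, 2}" "length x + length y \<le> N"
  shows "mixing_from r (mon x) (mon y) =
    (\<Sum>s\<in>{1,2}. \<Sum>n\<in>{2..N+2}. mix_op r s n (mon x) (mon y))"
  unfolding mixing_from_def
proof (rule sum.cong[OF refl])
  fix s :: nat assume s: "s \<in> {1, 2}"
  let ?f = "\<lambda>n. if n \<ge> 2 \<and> even (int n - int r - int s - 1)
    then mix_op r s n (mon x) (mon y) else 0"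
  have "?f n = 0" if "n \<notin> {2..N+2}" for n
    using mix_op_eq_0[of "mon x" "length x" "mon y" "length y" n r s] that assms(2)
    by (auto simp: mon_def)
  then have "{n. ?f n \<noteq> 0} \<subseteq> {2..N+2}"
    by blast
  then have "Sum_any ?f = sum ?f {2..N+2}"
    by (intro Sum_any.expand_superset) simp_all
  also have "\<dots> = (\<Sum>n\<in>{2..N+2}. mix_op r s n (mon x) (mon y))"
    using mix_op_parity[OF assms(1) s] by (intro sum.cong) auto
  finally show "Sum_any ?f = \<dots>" .
qed

lemma sum_from_2:
  fixes f :: "nat \<Rightarrow> 'b::comm_monoid_add"
  shows "(\<Sum>n\<in>{2..Suc N + 2}. f n) = f 2 + (\<Sum>n\<in>{2..N + 2}. f (Suc n))"
  using sum.atLeast_Suc_atMost[of 2 "Suc N + 2" f]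
  by (simp only: add_Suc sum.shift_bounds_cl_Suc_ivl)

text \<open>The summands with \<open>n = 2\<close> give \<open>u a v\<close>, where only
  \<open>s = 2\<close> is nonzero. Those with larger \<open>n\<close> unfold one step of the
  recursion, and the sums are exchanged with the coproduct.\<close>

lemma mixing_from_1:
  "mixing_from 1 u v = u * var_a * v + sweedler (\<lambda>x y. x * var_a * mixing_from 2 y v) u"
proof (rule qbilinear_eqI[where B = "mixing_from 1"])
  note intros = qlinear_sweedler qlinear_sweedler_values qlinear_plus
    qbilinearD2[OF qbilinear_mixing_from] qlinear_mult_left qlinear_mult_right qlinear_id
  show "qbilinear (\<lambda>u v. u * var_a * v + sweedler (\<lambda>x y. x * var_a * mixing_from 2 y v) u)"
    unfolding qbilinear_def by (intro conjI allI; (rule intros)+)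
  fix w z :: word
  let ?u = "mon w" and ?v = "mon z" and ?N = "length w + length z"
  have base: "(\<Sum>s\<in>{1,2}. mix_op 1 s 2 ?u ?v) = ?u * var_a * ?v"
    by (simp add: numeral_2_eq_2)
  \<comment> \<open>The range is one longer than the lengths require, so that after the shift of
    \<open>n\<close> it still suffices for the pieces of \<open>w\<close>.\<close>
  have "mixing_from 1 ?u ?v = (\<Sum>s\<in>{1,2}. \<Sum>n\<in>{2..Suc ?N + 2}. mix_op 1 s n ?u ?v)"
    by (rule mixing_from_mon) auto
  also have "\<dots> = ?u * var_a * ?v + (\<Sum>s\<in>{1,2}. \<Sum>n\<in>{2..?N + 2}. mix_op 1 s (Suc n) ?u ?v)"
    unfolding sum_from_2 sum.distrib base ..
  also have "(\<Sum>s\<in>{1,2}. \<Sum>n\<in>{2..?N + 2}. mix_op 1 s (Suc n) ?u ?v) =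
      (\<Sum>s\<in>{1,2}. \<Sum>n\<in>{2..?N + 2}. \<Sum>i<length w.
        mon (take i w) * var_a * mix_op 2 s n (mon (drop (Suc i) w)) ?v)"
    by (intro sum.cong refl) (auto simp: sweedler_mon)
  also have "\<dots> = (\<Sum>i<length w. mon (take i w) * var_a *
      (\<Sum>s\<in>{1,2}. \<Sum>n\<in>{2..?N + 2}. mix_op 2 s n (mon (drop (Suc i) w)) ?v))"
    by (simp only: sum_distrib_left sum.swap[of _ "{1, 2}" "{..<length w}"]
        sum.swap[of _ "{2..?N + 2}" "{..<length w}"])
  also have "\<dots> = sweedler (\<lambda>x y. x * var_a * mixing_from 2 y ?v) ?u"
    unfolding sweedler_mon
    by (intro sum.cong refl arg_cong[of _ _ "(*) _"] mixing_from_mon[symmetric]) auto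
  finally show "mixing_from 1 ?u ?v =
      ?u * var_a * ?v + sweedler (\<lambda>x y. x * var_a * mixing_from 2 y ?v) ?u" .
qed (rule qbilinear_mixing_from)

text \<open>Mirror image of \<open>mixing_from_1\<close>: pieces of \<open>v\<close> are followed by
  \<open>b\<close>, and at \<open>n = 2\<close> only \<open>s = 1\<close> is nonzero.\<close>

lemma mixing_from_2:
  "mixing_from 2 u v = v * var_b * u + sweedler (\<lambda>x y. x * var_b * mixing_from 1 u y) v"
proof (rule qbilinear_eqI[where B = "mixing_from 2"])
  note intros = qlinear_sweedler qlinear_sweedler_values qlinear_plus
    qbilinearD1[OF qbilinear_mixing_from] qlinear_mult_left qlinear_mult_right qlinear_id
  show "qbilinear (\<lambda>u v. v * var_b * u + sweedler (\<lambda>x y. x * var_b * mixing_from 1 u y) v)"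
    unfolding qbilinear_def by (intro conjI allI; (rule intros)+)
  fix w z :: word
  let ?u = "mon w" and ?v = "mon z" and ?N = "length w + length z"
  have base: "(\<Sum>s\<in>{1,2}. mix_op 2 s 2 ?u ?v) = ?v * var_b * ?u"
    by (simp add: numeral_2_eq_2)
  have "mixing_from 2 ?u ?v = (\<Sum>s\<in>{1,2}. \<Sum>n\<in>{2..Suc ?N + 2}. mix_op 2 s n ?u ?v)"
    by (rule mixing_from_mon) auto
  also have "\<dots> = ?v * var_b * ?u + (\<Sum>s\<in>{1,2}. \<Sum>n\<in>{2..?N + 2}. mix_op 2 s (Suc n) ?u ?v)"
    unfolding sum_from_2 sum.distrib base ..
  also have "(\<Sum>s\<in>{1,2}. \<Sum>n\<in>{2..?N + 2}. mix_op 2 s (Suc n) ?u ?v) =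
      (\<Sum>s\<in>{1,2}. \<Sum>n\<in>{2..?N + 2}. \<Sum>i<length z.
        mon (take i z) * var_b * mix_op 1 s n ?u (mon (drop (Suc i) z)))"
    by (intro sum.cong refl) (auto simp: sweedler_mon)
  also have "\<dots> = (\<Sum>i<length z. mon (take i z) * var_b *
      (\<Sum>s\<in>{1,2}. \<Sum>n\<in>{2..?N + 2}. mix_op 1 s n ?u (mon (drop (Suc i) z))))"
    by (simp only: sum_distrib_left sum.swap[of _ "{1, 2}" "{..<length z}"]
        sum.swap[of _ "{2..?N + 2}" "{..<length z}"])
  also have "\<dots> = sweedler (\<lambda>x y. x * var_b * mixing_from 1 ?u y) ?v"
    unfolding sweedler_mon
    by (intro sum.cong refl arg_cong[of _ _ "(*) _"] mixing_from_mon[symmetric]) auto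
  finally show "mixing_from 2 ?u ?v =
      ?v * var_b * ?u + sweedler (\<lambda>x y. x * var_b * mixing_from 1 ?u y) ?v" .
qed (rule qbilinear_mixing_from)


section \<open>Weighted chain sums\<close>

text \<open>The monomial of a rank set after \<open>a\<close> is replaced by \<open>a - b\<close>,
  for the ranks strictly between \<open>m\<close> and \<open>n\<close>. Absolute ranks let a chain
  be cut at an element without reindexing.\<close>

definition chain_word :: "nat set \<Rightarrow> nat \<Rightarrow> nat \<Rightarrow> ab_alg" where
  "chain_word S m n = prod_list (map (\<lambda>i. if i \<in> S then var_b else var_e) [Suc m..<n])"

lemma chain_word_empty: "chain_word {} m n = var_e ^ (n - m - 1)"
  by (simp add: chain_word_def map_replicate_const)

text \<open>\<open>k\<close> is the least rank in the set, so all letters before it are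
  \<open>var_e\<close>.\<close>

lemma chain_word_insert:
  assumes "m < k" "k < n" "\<And>i. i \<in> S \<Longrightarrow> k < i"
  shows "chain_word (insert k S) m n = var_e ^ (k - m - 1) * var_b * chain_word S k n"
proof -
  have split: "[Suc m..<n] = [Suc m..<k] @ k # [Suc k..<n]"
    using assms(1,2) upt_add_eq_append[of "Suc m" k "n - k"] by (simp add: upt_conv_Cons)
  have pre: "map (\<lambda>i. if i \<in> insert k S then var_b else var_e) [Suc m..<k] =
      map (\<lambda>_. var_e) [Suc m..<k]"
    by (intro map_cong) (auto dest: assms(3))
  have post: "map (\<lambda>i. if i \<in> insert k S then var_b else var_e) [Suc k..<n] =
      map (\<lambda>i. if i \<in> S then var_b else var_e) [Suc k..<n]"
    by (intro map_cong) auto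
  show ?thesis
    unfolding chain_word_def split map_append list.map pre post
    by (simp add: map_replicate_const mult.assoc)
qed

text \<open>Reading backwards replaces each rank \<open>i\<close> by \<open>N - i\<close>; the bound
  \<open>n \<le> N\<close> keeps the subtraction from truncating.\<close>

lemma word_star_chain_word:
  assumes "S \<subseteq> {m<..<n}" "n \<le> N"
  shows "word_star (chain_word S m n) = chain_word ((-) N ` S) (N - n) (N - m)"
proof -
  \<comment> \<open>Position \<open>i\<close> of the reversed word carries the rank
    \<open>n - 1 - i\<close>, which becomes \<open>N - n + 1 + i\<close>.\<close>
  have mem: "n - Suc i \<in> S \<longleftrightarrow> Suc (N - n + i) \<in> (-) N ` S" if "i < n - Suc m" for i
  proof
    assume "n - Suc i \<in> S"
    then show "Suc (N - n + i) \<in> (-) N ` S"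
      using that assms(2) by (intro image_eqI[of _ _ "n - Suc i"]) auto
  next
    assume "Suc (N - n + i) \<in> (-) N ` S"
    then obtain j where "j \<in> S" "Suc (N - n + i) = N - j" by auto
    moreover from this assms have "j < n" by auto
    ultimately show "n - Suc i \<in> S"
      using assms(2) by (metis Suc_diff_Suc add_diff_cancel_left' diff_diff_cancel diff_diff_left
          le_add_diff_inverse2 less_imp_le_nat add_Suc_right add.commute diff_le_self le_trans)
  qed
  have "rev (map word_star (map (\<lambda>i. if i \<in> S then var_b else var_e) [Suc m..<n])) =
      map (\<lambda>i. if i \<in> (-) N ` S then var_b else var_e) [Suc (N - n)..<N - m]"
  proof (rule nth_equalityI)
    fix i assume "i < length (rev (map word_star
      (map (\<lambda>i. if i \<in> S then var_b else var_e) [Suc m..<n])))"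
    then have i: "i < n - Suc m" by simp
    then have "Suc m + (n - Suc m - Suc i) = n - Suc i" by simp
    with i mem[OF i] assms(2) show "rev (map word_star
        (map (\<lambda>i. if i \<in> S then var_b else var_e) [Suc m..<n])) ! i =
      map (\<lambda>i. if i \<in> (-) N ` S then var_b else var_e) [Suc (N - n)..<N - m] ! i"
      by (simp add: rev_nth word_star_var del: upt_Suc)
  qed (use assms(2) in auto)
  then show ?thesis
    by (simp add: chain_word_def word_star_prod_list)
qed

section \<open>Chains in open intervals and their weights\<close>

definition open_chains :: "'a set \<Rightarrow> 'a rel \<Rightarrow> 'a \<Rightarrow> 'a \<Rightarrow> 'a set set" where
  "open_chains P r x y = {C. C \<subseteq> {z \<in> P. less_in r x z \<and> less_in r z y} \<and> C \<in> Chains r}"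

text \<open>The weight of the empty chain. The value 0 outside \<open>x < y\<close> makes this an
  element of the incidence algebra, so that sums may run over the whole carrier.\<close>

definition kappa :: "'a rel \<Rightarrow> ('a \<Rightarrow> nat) \<Rightarrow> 'a \<Rightarrow> 'a \<Rightarrow> ab_alg" where
  "kappa r \<rho> x y = (if less_in r x y then var_e ^ (\<rho> y - \<rho> x - 1) else 0)"

text \<open>The \<open>ab\<close>-index of the interval \<open>[x, y]\<close>, with the junk value \<open>0\<close> unless \<open>x < y\<close>.\<close>
definition psi :: "'a set \<Rightarrow> 'a rel \<Rightarrow> ('a \<Rightarrow> nat) \<Rightarrow> 'a \<Rightarrow> 'a \<Rightarrow> ab_alg" where
  "psi P r \<rho> x y = (if less_in r x y
     then \<Sum>C\<in>open_chains P r x y. chain_word (\<rho> ` C) (\<rho> x) (\<rho> y) else 0)"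

text \<open>Only elements strictly between the ends enter the sum. This serves to cut the carrier
  down to an up-set or a down-set and to exchange rank functions.\<close>

lemma psi_cong:
  assumes "\<And>z. less_in r x z \<Longrightarrow> less_in r z y \<Longrightarrow> z \<in> P \<longleftrightarrow> z \<in> P'"
    and "\<And>z. z \<in> P \<Longrightarrow> \<rho> z = \<rho>' z" "\<rho> x = \<rho>' x" "\<rho> y = \<rho>' y"
  shows "psi P r \<rho> x y = psi P' r \<rho>' x y"
proof -
  have "{z \<in> P. less_in r x z \<and> less_in r z y} = {z \<in> P'. less_in r x z \<and> less_in r z y}"
    using assms(1) by blast
  then have "open_chains P r x y = open_chains P' r x y"
    by (simp add: open_chains_def)
  moreover have "\<rho> ` C = \<rho>' ` C" if "C \<in> open_chains P r x y" for C
    using that assms(2) by (intro image_cong) (auto simp: open_chains_def)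
  ultimately show ?thesis
    using assms(3,4) by (auto simp: psi_def intro!: sum.cong)
qed

text \<open>Asking only that ranks increase strictly admits up-sets with their inherited ranks,
  which need not start at 0, and reversed down-sets. The relation may extend beyond the carrier, so
  such subsets keep it unrestricted.\<close>

locale ranked_poset =
  fixes P :: "'a set" and r :: "'a rel" and \<rho> :: "'a \<Rightarrow> nat"
  assumes finite_carrier: "finite P" and refl: "refl_on P r" and trans: "trans r"
    and antisym: "antisym r"
    and rank_less: "\<And>x y. x \<in> P \<Longrightarrow> y \<in> P \<Longrightarrow> less_in r x y \<Longrightarrow> \<rho> x < \<rho> y"
begin

abbreviation lt (infix "\<prec>" 50) where "x \<prec> y \<equiv> less_in r x y"

lemma lt_trans: "x \<prec> y \<Longrightarrow> y \<prec> z \<Longrightarrow> x \<prec> z"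
  using trans antisym unfolding less_in_def trans_def antisym_def by blast

lemma lt_irrefl: "\<not> x \<prec> x"
  by (simp add: less_in_def)

text \<open>Going up brings the rank closer to its maximum.\<close>

lemma up_induct [consumes 1, case_names up]:
  assumes "x \<in> P" and "\<And>x. x \<in> P \<Longrightarrow> (\<And>q. q \<in> P \<Longrightarrow> x \<prec> q \<Longrightarrow> \<Phi> q) \<Longrightarrow> \<Phi> x"
  shows "\<Phi> x"
  using assms(1)
proof (induction "Max (\<rho> ` P) - \<rho> x" arbitrary: x rule: less_induct)
  case less
  show ?case
  proof (rule assms(2)[OF less.prems])
    fix q assume q: "q \<in> P" "x \<prec> q"
    then have "\<rho> q \<le> Max (\<rho> ` P)" "\<rho> x < \<rho> q"
      using finite_carrier rank_less less.prems by auto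
    then show "\<Phi> q" using q by (intro less.hyps) auto
  qed
qed

lemma finite_open_chains: "finite (open_chains P r x y)"
  by (rule finite_subset[of _ "Pow P"]) (auto simp: open_chains_def finite_carrier)

lemma open_chains_decomp:
  assumes "x \<in> P" "y \<in> P"
  shows "open_chains P r x y =
    insert {} (\<Union>q\<in>{q \<in> P. x \<prec> q \<and> q \<prec> y}. insert q ` open_chains P r q y)" (is "_ = ?R")
proof (intro equalityI subsetI)
  fix C assume C: "C \<in> open_chains P r x y"
  then have fin: "finite C"
    using finite_carrier by (auto simp: open_chains_def intro: finite_subset)
  show "C \<in> ?R"
  proof (cases "C = {}")
    case False
    \<comment> \<open>An element of least rank is the least element: chain elements are comparable
      and ranks strictly monotone.\<close>
    with fin have "Min (\<rho> ` C) \<in> \<rho> ` C" by simp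
    then obtain q where q: "q \<in> C" "\<rho> q = Min (\<rho> ` C)" by auto
    have "q \<prec> z" if "z \<in> C" "z \<noteq> q" for z
    proof -
      have "\<not> z \<prec> q"
      proof
        assume "z \<prec> q"
        moreover have "z \<in> P" "q \<in> P" using that(1) q(1) C by (auto simp: open_chains_def)
        ultimately have "\<rho> z < \<rho> q" by (intro rank_less)
        moreover have "\<rho> q \<le> \<rho> z" using q(2) fin that(1) by simp
        ultimately show False by simp
      qed
      with that q C show ?thesis by (auto simp: open_chains_def Chains_def less_in_def)
    qed
    then have "C - {q} \<in> open_chains P r q y"
      using C by (auto simp: open_chains_def Chains_def)
    moreover have "q \<in> {q \<in> P. x \<prec> q \<and> q \<prec> y}" "C = insert q (C - {q})"
      using C q by (auto simp: open_chains_def)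
    ultimately show ?thesis by blast
  qed simp
next
  fix C assume "C \<in> ?R"
  then consider "C = {}" | q D where "q \<in> P" "x \<prec> q" "q \<prec> y" "D \<in> open_chains P r q y" "C = insert q D"
    by blast
  then show "C \<in> open_chains P r x y"
  proof cases
    case 1
    then show ?thesis by (simp add: open_chains_def Chains_def)
  next
    case 2
    have D: "D \<subseteq> {z \<in> P. q \<prec> z \<and> z \<prec> y}" "D \<in> Chains r"
      using 2(4) by (auto simp: open_chains_def)
    then have "C \<subseteq> {z \<in> P. x \<prec> z \<and> z \<prec> y}"
      using 2 by (auto intro: lt_trans)
    moreover have "C \<in> Chains r"
      using D 2(1) refl unfolding 2(5) Chains_def refl_on_def less_in_def by blast
    ultimately show ?thesis by (simp add: open_chains_def)
  qed
qed

text \<open>Chains are grouped by their least element \<open>q\<close>, where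
  \<open>chain_word_insert\<close> factors the weight; the empty chain gives the first
  summand.\<close>

lemma psi_rec:
  assumes xy: "x \<in> P" "y \<in> P"
  shows "psi P r \<rho> x y = kappa r \<rho> x y + (\<Sum>q\<in>P. kappa r \<rho> x q * var_b * psi P r \<rho> q y)"
proof (cases "x \<prec> y")
  case False
  then have "kappa r \<rho> x q * var_b * psi P r \<rho> q y = 0" for q
    using lt_trans by (auto simp: kappa_def psi_def)
  with False show ?thesis by (simp add: kappa_def psi_def)
next
  case True
  let ?I = "{q \<in> P. x \<prec> q \<and> q \<prec> y}" and ?O = "\<lambda>q. open_chains P r q y"
  let ?w = "\<lambda>C. chain_word (\<rho> ` C) (\<rho> x) (\<rho> y)"
  have O_above: "q \<prec> z" "z \<in> P" if "C \<in> ?O q" "z \<in> C" for q z C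
    using that by (auto simp: open_chains_def)
  \<comment> \<open>A chain determines its least element: a common set would put \<open>q\<close>
    and \<open>q'\<close> strictly below each other.\<close>
  have "insert q ` ?O q \<inter> insert q' ` ?O q' = {}" if "q \<noteq> q'" for q q'
  proof -
    have False if "insert q C = insert q' C'" "C \<in> ?O q" "C' \<in> ?O q'" for C C'
      using that \<open>q \<noteq> q'\<close> O_above lt_trans lt_irrefl by (metis insert_iff)
    then show ?thesis by blast
  qed
  moreover have "inj_on (insert q) (?O q)" for q
    by (rule inj_onI) (metis O_above(1) insert_ident lt_irrefl)
  ultimately have "sum ?w (\<Union>q\<in>?I. insert q ` ?O q) = (\<Sum>q\<in>?I. \<Sum>C\<in>?O q. ?w (insert q C))"
    using finite_carrier finite_open_chains
    by (subst sum.UNION_disjoint) (auto simp: sum.reindex)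
  also have "\<dots> = (\<Sum>q\<in>?I. kappa r \<rho> x q * var_b * psi P r \<rho> q y)"
  proof (rule sum.cong[OF HOL.refl])
    fix q assume q: "q \<in> ?I"
    have "?w (insert q C) = var_e ^ (\<rho> q - \<rho> x - 1) * var_b * chain_word (\<rho> ` C) (\<rho> q) (\<rho> y)"
      if "C \<in> ?O q" for C
      unfolding image_insert
      by (rule chain_word_insert) (use q xy that O_above rank_less in auto)
    then show "(\<Sum>C\<in>?O q. ?w (insert q C)) = kappa r \<rho> x q * var_b * psi P r \<rho> q y"
      using q by (simp add: kappa_def psi_def sum_distrib_left)
  qed
  also have "\<dots> = (\<Sum>q\<in>P. kappa r \<rho> x q * var_b * psi P r \<rho> q y)"
    by (rule sum.mono_neutral_left) (auto simp: finite_carrier kappa_def psi_def)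
  finally have "sum ?w (\<Union>q\<in>?I. insert q ` ?O q) =
    (\<Sum>q\<in>P. kappa r \<rho> x q * var_b * psi P r \<rho> q y)" .
  moreover have "sum ?w (open_chains P r x y) = ?w {} + sum ?w (\<Union>q\<in>?I. insert q ` ?O q)"
    unfolding open_chains_decomp[OF xy]
    by (rule sum.insert) (auto simp: finite_carrier finite_open_chains)
  ultimately show ?thesis
    using True by (simp add: psi_def[of P r \<rho> x y] kappa_def[of r \<rho> x y] chain_word_empty)
qed

text \<open>The converse order has the same chains; only their ranks are reversed, as in
  \<open>word_star_chain_word\<close>.\<close>

lemma psi_converse:
  assumes "x \<in> P" "y \<in> P" "\<rho> y \<le> N"
  shows "psi P (r\<inverse>) (\<lambda>z. N - \<rho> z) y x = word_star (psi P r \<rho> x y)"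
proof -
  have lt: "less_in (r\<inverse>) u v \<longleftrightarrow> v \<prec> u" for u v
    by (auto simp: less_in_def)
  have "open_chains P (r\<inverse>) y x = open_chains P r x y"
    by (auto simp: open_chains_def Chains_def lt)
  moreover have "word_star (chain_word (\<rho> ` C) (\<rho> x) (\<rho> y)) =
      chain_word ((\<lambda>z. N - \<rho> z) ` C) (N - \<rho> y) (N - \<rho> x)" if "C \<in> open_chains P r x y" for C
  proof -
    have "\<rho> ` C \<subseteq> {\<rho> x<..<\<rho> y}"
      using that assms rank_less by (auto simp: open_chains_def)
    from word_star_chain_word[OF this assms(3)] show ?thesis
      by (simp add: image_image)
  qed
  ultimately show ?thesis
    by (simp add: psi_def lt qlinear_sum[OF qlinear_word_star] qlinear_0[OF qlinear_word_star])
qed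

text \<open>Induction from the top downwards for all \<open>B\<close> at once, applying the
  derivation rule to \<open>psi_rec\<close>.\<close>

lemma sweedler_psi:
  assumes "x \<in> P" "y \<in> P" "qbilinear B"
  shows "sweedler B (psi P r \<rho> x y) = (\<Sum>z\<in>P. B (psi P r \<rho> x z) (psi P r \<rho> z y))"
  using assms
proof (induction x arbitrary: B rule: up_induct)
  case (up x)
  note B = \<open>qbilinear B\<close>
  let ?\<psi> = "psi P r \<rho>" and ?\<kappa> = "kappa r \<rho> x"
  note B1 = qbilinearD1[OF B qlinear_id] and B2 = qbilinearD2[OF B qlinear_id]
  have sweedler_kappa: "sweedler C (?\<kappa> q) = 0" if "qbilinear C" for C q
    using that by (simp add: kappa_def sweedler_var_e_power qlinear_0[OF qlinear_sweedler])
  \<comment> \<open>Deletion inside \<open>kappa\<close> contributes nothing, deletion of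
    \<open>b\<close> leaves \<open>kappa\<close> and \<open>psi\<close>, and deletion inside
    \<open>psi\<close> is the induction hypothesis for \<open>B\<close> with a prefix absorbed into
    its first argument.\<close>
  have step: "sweedler B (?\<kappa> q * var_b * ?\<psi> q y) =
      B (?\<kappa> q) (?\<psi> q y) + (\<Sum>w\<in>P. B (?\<kappa> q * var_b * ?\<psi> q w) (?\<psi> w y))" if "q \<in> P" for q
  proof (cases "x \<prec> q")
    case False
    then show ?thesis
      by (simp add: kappa_def qlinear_0[OF qlinear_sweedler] qlinear_0[OF B1])
  next
    case True
    have "qbilinear (\<lambda>u v. B u (v * ?\<psi> q y))"
      by (intro qbilinear_compose[OF B, of "\<lambda>u. u" "\<lambda>v. v * ?\<psi> q y"] qlinear_mult_right qlinear_id)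
    moreover from this have "qbilinear (\<lambda>u v. B u (v * var_b * ?\<psi> q y))"
      by (rule qbilinear_compose[of "\<lambda>u v. B u (v * ?\<psi> q y)" "\<lambda>u. u" "\<lambda>v. v * var_b"])
        (intro qlinear_mult_right qlinear_id)+
    ultimately have "sweedler (\<lambda>u v. B u (v * ?\<psi> q y)) (?\<kappa> q * var_b) = B (?\<kappa> q) (?\<psi> q y)"
      by (simp add: sweedler_mult sweedler_kappa sweedler_var)
    moreover have "sweedler (\<lambda>u. B (?\<kappa> q * var_b * u)) (?\<psi> q y) =
        (\<Sum>w\<in>P. B (?\<kappa> q * var_b * ?\<psi> q w) (?\<psi> w y))"
      using that True up.prems(1)
      by (intro up.IH[where B = "\<lambda>u. B (?\<kappa> q * var_b * u)"])
        (auto intro!: qbilinear_compose[OF B, of "\<lambda>u. ?\<kappa> q * var_b * u" "\<lambda>v. v"] qlinear_mult_left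
          qlinear_id)
    ultimately show ?thesis
      by (simp add: sweedler_mult[OF B])
  qed
  have "sweedler B (?\<psi> x y) = (\<Sum>q\<in>P. sweedler B (?\<kappa> q * var_b * ?\<psi> q y))"
    by (subst psi_rec[OF up.hyps up.prems(1)])
      (simp add: qlinear_add[OF qlinear_sweedler] qlinear_sum[OF qlinear_sweedler] sweedler_kappa B)
  also have "\<dots> = (\<Sum>w\<in>P. B (?\<kappa> w) (?\<psi> w y)) +
      (\<Sum>w\<in>P. \<Sum>q\<in>P. B (?\<kappa> q * var_b * ?\<psi> q w) (?\<psi> w y))"
    by (simp add: step sum.distrib, rule sum.swap)
  \<comment> \<open>For fixed \<open>w\<close> the first arguments add up to \<open>psi\<close> from
    \<open>x\<close> to \<open>w\<close>, again by \<open>psi_rec\<close>.\<close>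
  also have "\<dots> = (\<Sum>w\<in>P. B (?\<psi> x w) (?\<psi> w y))"
    unfolding sum.distrib[symmetric]
    by (intro sum.cong HOL.refl)
      (simp add: psi_rec[OF up.hyps] qlinear_add[OF B1] qlinear_sum[OF B1])
  finally show ?case .
qed

text \<open>In the incidence algebra, \<open>psi = (1 - kappa b)\<inverse> kappa\<close>.\<close>
lemma psi_resolvent:
  assumes "x \<in> P"
  shows "(\<Sum>z\<in>P. psi P r \<rho> x z * h z) =
    (\<Sum>z\<in>P. kappa r \<rho> x z * (h z + var_b * (\<Sum>w\<in>P. psi P r \<rho> z w * h w)))"
proof -
  have "(\<Sum>z\<in>P. psi P r \<rho> x z * h z) = (\<Sum>z\<in>P. kappa r \<rho> x z * h z) +
      (\<Sum>z\<in>P. \<Sum>q\<in>P. kappa r \<rho> x q * var_b * psi P r \<rho> q z * h z)"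
    unfolding sum.distrib[symmetric]
    by (intro sum.cong HOL.refl) (simp add: psi_rec[OF assms] distrib_right sum_distrib_right)
  also have "(\<Sum>z\<in>P. \<Sum>q\<in>P. kappa r \<rho> x q * var_b * psi P r \<rho> q z * h z) =
      (\<Sum>q\<in>P. \<Sum>z\<in>P. kappa r \<rho> x q * var_b * psi P r \<rho> q z * h z)"
    by (rule sum.swap)
  finally show ?thesis
    by (simp add: distrib_left sum.distrib sum_distrib_left mult.assoc)
qed

end


section \<open>The \<open>ab\<close>-index of a product\<close>

text \<open>\<open>Q\<close> is the product of \<open>P1\<close> and \<open>P2\<close>, transported along \<open>f\<close>; ranks are only required to
  add up to a constant.\<close>
locale ranked_product =
  A: ranked_poset P1 r1 \<rho>1 + B: ranked_poset P2 r2 \<rho>2 + Q: ranked_poset Q s \<tau>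
  for P1 :: "'a set" and r1 \<rho>1 and P2 :: "'b set" and r2 \<rho>2 and Q :: "'c set" and s \<tau> +
  fixes f :: "'a \<Rightarrow> 'b \<Rightarrow> 'c" and c :: nat and t1 :: 'a and t2 :: 'b
  assumes bij: "bij_betw (\<lambda>(x, y). f x y) (P1 \<times> P2) Q"
    and less_iff: "\<And>x y x' y'. x \<in> P1 \<Longrightarrow> x' \<in> P1 \<Longrightarrow> y \<in> P2 \<Longrightarrow> y' \<in> P2 \<Longrightarrow>
      less_in s (f x y) (f x' y') \<longleftrightarrow>
        (x, y) \<noteq> (x', y') \<and> (x = x' \<or> less_in r1 x x') \<and> (y = y' \<or> less_in r2 y y')"
    and rank: "\<And>x y. x \<in> P1 \<Longrightarrow> y \<in> P2 \<Longrightarrow> \<tau> (f x y) + c = \<rho>1 x + \<rho>2 y"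
    and top1: "t1 \<in> P1" "\<And>x. x \<in> P1 \<Longrightarrow> x \<noteq> t1 \<Longrightarrow> less_in r1 x t1"
    and top2: "t2 \<in> P2" "\<And>y. y \<in> P2 \<Longrightarrow> y \<noteq> t2 \<Longrightarrow> less_in r2 y t2"
begin

abbreviation "U \<equiv> psi P1 r1 \<rho>1"
abbreviation "V \<equiv> psi P2 r2 \<rho>2"

lemma psi_top1: "U t1 x = 0" if "x \<in> P1" for x
proof -
  have "\<not> less_in r1 t1 x"
    using that top1 A.lt_trans A.lt_irrefl by metis
  then show ?thesis by (simp add: psi_def)
qed

lemma psi_top2: "V t2 y = 0" if "y \<in> P2" for y
proof -
  have "\<not> less_in r2 t2 y"
    using that top2 B.lt_trans B.lt_irrefl by metis
  then show ?thesis by (simp add: psi_def)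
qed

text \<open>A pair grows in one coordinate or in both. In the latter case, with rank differences
  \<open>i\<close> and \<open>j\<close>, the exponent \<open>i + j - 1\<close> is
  \<open>(i - 1) + 1 + (j - 1)\<close>, whence the \<open>var_e\<close> in the middle.\<close>

lemma kappa_product:
  assumes "x \<in> P1" "x' \<in> P1" "y \<in> P2" "y' \<in> P2"
  shows "kappa s \<tau> (f x y) (f x' y') =
    (if y' = y then kappa r1 \<rho>1 x x' else 0) + (if x' = x then kappa r2 \<rho>2 y y' else 0) +
    kappa r1 \<rho>1 x x' * var_e * kappa r2 \<rho>2 y y'"
proof -
  have rk: "\<tau> (f x' y') - \<tau> (f x y) = (\<rho>1 x' + \<rho>2 y') - (\<rho>1 x + \<rho>2 y)"
    using rank[OF assms(1,3)] rank[OF assms(2,4)] by simp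
  consider "x = x'" "y = y'" | "x = x'" "y \<noteq> y'" | "x \<noteq> x'" "y = y'" | "x \<noteq> x'" "y \<noteq> y'" by blast
  then show ?thesis
  proof cases
    case 4
    show ?thesis
    proof (cases "less_in r1 x x' \<and> less_in r2 y y'")
      case True
      with A.rank_less[of x x'] B.rank_less[of y y'] assms
      have "\<rho>1 x < \<rho>1 x'" "\<rho>2 y < \<rho>2 y'" by auto
      then have "\<rho>1 x' + \<rho>2 y' - (\<rho>1 x + \<rho>2 y) - 1 =
          Suc (\<rho>1 x' - \<rho>1 x - 1) + (\<rho>2 y' - \<rho>2 y - 1)" by simp
      then have "var_e ^ (\<rho>1 x' + \<rho>2 y' - (\<rho>1 x + \<rho>2 y) - 1) =
          var_e ^ (\<rho>1 x' - \<rho>1 x - 1) * var_e * var_e ^ (\<rho>2 y' - \<rho>2 y - 1)"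
        by (simp only: power_add power_Suc2)
      then show ?thesis
        using True 4 assms by (simp add: kappa_def less_iff rk)
    next
      case False
      then show ?thesis using 4 assms by (auto simp: kappa_def less_iff)
    qed
  qed (use assms rk in \<open>auto simp: kappa_def less_iff A.lt_irrefl B.lt_irrefl\<close>)
qed

text \<open>\<open>X\<close> (\<open>Y\<close>) sums the alternating words in blocks \<open>U a\<close> and \<open>V b\<close> that start with a
  \<open>U\<close>-block (\<open>V\<close>-block), including those with a single block.\<close>
definition X :: "'a \<Rightarrow> 'b \<Rightarrow> ab_alg" where
  "X x y = (if x = t1 then 0 else if y = t2 then U x t1 else mixing_from 1 (U x t1) (V y t2))"

definition Y :: "'a \<Rightarrow> 'b \<Rightarrow> ab_alg" where
  "Y x y = (if y = t2 then 0 else if x = t1 then V y t2 else mixing_from 2 (U x t1) (V y t2))"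

text \<open>The coproduct formula cuts \<open>U x t1\<close> at \<open>z\<close>; what follows the
  letter \<open>a\<close> starts with a \<open>V\<close>-block. The indicator supplies the word with
  a single block.\<close>

lemma X_rec:
  assumes "x \<in> P1" "y \<in> P2"
  shows "X x y = (\<Sum>z\<in>P1. U x z * ((if z = t1 \<and> y = t2 then 1 else 0) + var_a * Y z y))"
proof -
  have if_mult: "u * (if P then 1 else 0) = (if P then u else 0)" for u :: ab_alg and P by simp
  consider "x = t1" | "x \<noteq> t1" "y = t2" | "x \<noteq> t1" "y \<noteq> t2" by blast
  then show ?thesis
  proof cases
    case 1
    then show ?thesis by (simp add: X_def psi_top1)
  next
    case 2
    then show ?thesis
      using top1(1) A.finite_carrier by (simp add: X_def Y_def if_mult)
  next
    case 3
    note mf = qbilinearD1[OF qbilinear_mixing_from qlinear_id]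
    have "qbilinear (\<lambda>u v. u * var_a * mixing_from 2 v (V y t2))"
      unfolding qbilinear_def by (intro conjI allI qlinear_mult_right qlinear_mult_left mf qlinear_id)
    then have "X x y = U x t1 * var_a * V y t2 +
        (\<Sum>z\<in>P1. U x z * var_a * mixing_from 2 (U z t1) (V y t2))"
      using 3 assms top1 mixing_from_1[of "U x t1" "V y t2"] by (simp add: X_def A.sweedler_psi)
    \<comment> \<open>The word \<open>U a V\<close> becomes the summand \<open>z = t1\<close>, where
      \<open>Y z y\<close> is \<open>V y t2\<close> and the mixing term is 0 because
      \<open>U t1 t1\<close> is.\<close>
    also have "\<dots> = (\<Sum>z\<in>P1. (if z = t1 then U x t1 * var_a * V y t2 else 0) +
        U x z * var_a * mixing_from 2 (U z t1) (V y t2))"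
      using top1(1) A.finite_carrier by (simp add: sum.distrib)
    also have "\<dots> = (\<Sum>z\<in>P1. U x z * (var_a * Y z y))"
      using 3 top1(1)
      by (intro sum.cong refl) (auto simp: Y_def psi_top1 mult.assoc qlinear_0[OF mf])
    finally show ?thesis using 3 by simp
  qed
qed

text \<open>Mirror image of \<open>X_rec\<close>: \<open>V y t2\<close> is cut, and the letter is
  \<open>b\<close>.\<close>

lemma Y_rec:
  assumes "x \<in> P1" "y \<in> P2"
  shows "Y x y = (\<Sum>z\<in>P2. V y z * ((if x = t1 \<and> z = t2 then 1 else 0) + var_b * X x z))"
proof -
  have if_mult: "u * (if P then 1 else 0) = (if P then u else 0)" for u :: ab_alg and P by simp
  consider "y = t2" | "y \<noteq> t2" "x = t1" | "x \<noteq> t1" "y \<noteq> t2" by blast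
  then show ?thesis
  proof cases
    case 1
    then show ?thesis by (simp add: Y_def psi_top2)
  next
    case 2
    then show ?thesis
      using top2(1) B.finite_carrier by (simp add: X_def Y_def if_mult)
  next
    case 3
    note mf = qbilinearD2[OF qbilinear_mixing_from qlinear_id]
    have "qbilinear (\<lambda>u v. u * var_b * mixing_from 1 (U x t1) v)"
      unfolding qbilinear_def by (intro conjI allI qlinear_mult_right qlinear_mult_left mf qlinear_id)
    then have "Y x y = V y t2 * var_b * U x t1 +
        (\<Sum>z\<in>P2. V y z * var_b * mixing_from 1 (U x t1) (V z t2))"
      using 3 assms top2 by (simp add: Y_def mixing_from_2[of "U x t1"] B.sweedler_psi)
    also have "\<dots> = (\<Sum>z\<in>P2. (if z = t2 then V y t2 * var_b * U x t1 else 0) +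
        V y z * var_b * mixing_from 1 (U x t1) (V z t2))"
      using top2(1) B.finite_carrier by (simp add: sum.distrib)
    also have "\<dots> = (\<Sum>z\<in>P2. V y z * (var_b * X x z))"
      using 3 top2(1)
      by (intro sum.cong refl) (auto simp: X_def psi_top2 mult.assoc qlinear_0[OF mf])
    finally show ?thesis using 3 by simp
  qed
qed

text \<open>The sum \<open>X + Y\<close> satisfies the recursion \<open>psi_rec\<close> of the
  product, so induction from the top identifies it with \<open>psi\<close>.\<close>

lemma psi_product_XY:
  assumes "x \<in> P1" "y \<in> P2"
  shows "psi Q s \<tau> (f x y) (f t1 t2) = X x y + Y x y"
proof -
  let ?k1 = "kappa r1 \<rho>1" and ?k2 = "kappa r2 \<rho>2" and ?k = "kappa s \<tau>"
  \<comment> \<open>The column of the top element in the identity of the incidence algebra.\<close>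
  define d :: "'a \<Rightarrow> 'b \<Rightarrow> ab_alg" where "d x y = (if x = t1 \<and> y = t2 then 1 else 0)" for x y
  define Z where "Z x y = d x y + var_b * (X x y + Y x y)" for x y
  have a: "var_a = var_e + var_b" by (simp add: var_e_def)
  \<comment> \<open>The resolvent replaces \<open>V\<close> by \<open>kappa\<close> and adds
    \<open>b Y\<close> to \<open>d + b X\<close>, which completes it to \<open>Z\<close>.\<close>
  have Y_kappa: "Y x y = (\<Sum>z\<in>P2. ?k2 y z * Z x z)" if "x \<in> P1" "y \<in> P2" for x y
  proof -
    have "Y x y = (\<Sum>z\<in>P2. V y z * (d x z + var_b * X x z))"
      using Y_rec[OF that] by (simp add: d_def)
    also have "\<dots> = (\<Sum>z\<in>P2. ?k2 y z * (d x z + var_b * X x z + var_b * Y x z))"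
      unfolding B.psi_resolvent[OF that(2)]
      using Y_rec[OF that(1)] by (intro sum.cong refl) (simp add: d_def)
    finally show ?thesis by (simp add: Z_def algebra_simps)
  qed
  \<comment> \<open>Here the completed argument is \<open>d + a Y + b X\<close>, which is
    \<open>Z + e Y\<close> because \<open>a = e + b\<close>.\<close>
  have X_kappa: "X x y = (\<Sum>z\<in>P1. ?k1 x z * (Z z y + var_e * Y z y))"
    if "x \<in> P1" "y \<in> P2" for x y
  proof -
    have "X x y = (\<Sum>z\<in>P1. U x z * (d z y + var_a * Y z y))"
      using X_rec[OF that] by (simp add: d_def)
    also have "\<dots> = (\<Sum>z\<in>P1. ?k1 x z * (d z y + var_a * Y z y + var_b * X z y))"
      unfolding A.psi_resolvent[OF that(1)]
      using X_rec[OF _ that(2)] by (intro sum.cong refl) (simp add: d_def)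
    finally show ?thesis by (simp add: Z_def a algebra_simps)
  qed
  \<comment> \<open>In the third term of \<open>kappa_product\<close> the inner sum over
    \<open>q\<close> collapses to \<open>Y\<close> by \<open>Y_kappa\<close>.\<close>
  have XY_kappa: "X x y + Y x y = (\<Sum>p\<in>P1. \<Sum>q\<in>P2. ?k (f x y) (f p q) * Z p q)"
    if xy: "x \<in> P1" "y \<in> P2" for x y
  proof -
    have "(\<Sum>p\<in>P1. \<Sum>q\<in>P2. ?k (f x y) (f p q) * Z p q) =
      (\<Sum>p\<in>P1. \<Sum>q\<in>P2. if q = y then ?k1 x p * Z p q else 0) +
      (\<Sum>p\<in>P1. \<Sum>q\<in>P2. if p = x then ?k2 y q * Z p q else 0) +
      (\<Sum>p\<in>P1. \<Sum>q\<in>P2. ?k1 x p * var_e * ?k2 y q * Z p q)"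
      unfolding sum.distrib[symmetric]
      using xy by (intro sum.cong refl) (simp add: kappa_product distrib_right)
    also have "(\<Sum>p\<in>P1. \<Sum>q\<in>P2. if q = y then ?k1 x p * Z p q else 0) =
        (\<Sum>p\<in>P1. ?k1 x p * Z p y)"
      using xy B.finite_carrier by simp
    also have "(\<Sum>p\<in>P1. \<Sum>q\<in>P2. if p = x then ?k2 y q * Z p q else 0) = Y x y"
      using xy A.finite_carrier by (subst sum.swap) (simp add: Y_kappa)
    also have "(\<Sum>p\<in>P1. \<Sum>q\<in>P2. ?k1 x p * var_e * ?k2 y q * Z p q) =
        (\<Sum>p\<in>P1. ?k1 x p * (var_e * Y p y))"
      using xy by (intro sum.cong refl) (simp add: Y_kappa sum_distrib_left mult.assoc)
    finally show ?thesis
      using xy by (simp add: X_kappa distrib_left sum.distrib)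
  qed
  have fQ: "f x y \<in> Q" if "x \<in> P1" "y \<in> P2" for x y
    using that bij by (auto simp: bij_betw_def)
  have reindex: "(\<Sum>q\<in>Q. g q) = (\<Sum>p\<in>P1. \<Sum>q\<in>P2. g (f p q))" for g :: "'c \<Rightarrow> ab_alg"
    by (simp add: sum.reindex_bij_betw[OF bij, symmetric] sum.cartesian_product case_prod_beta')
  have "\<forall>x\<in>P1. \<forall>y\<in>P2. w = f x y \<longrightarrow> psi Q s \<tau> w (f t1 t2) = X x y + Y x y" if "w \<in> Q" for w
    using that
  proof (induction w rule: Q.up_induct)
    case (up w)
    show ?case
    proof (intro ballI impI)
      fix x y assume xy: "x \<in> P1" "y \<in> P2" "w = f x y"
      have d_kappa: "(\<Sum>p\<in>P1. \<Sum>q\<in>P2. ?k w (f p q) * d p q) = ?k w (f t1 t2)"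
      proof -
        have "?k w (f p q) * d p q = (if q = t2 then if p = t1 then ?k w (f p q) else 0 else 0)" for p q
          by (simp add: d_def)
        then show ?thesis
          using top1(1) top2(1) A.finite_carrier B.finite_carrier by simp
      qed
      have "psi Q s \<tau> w (f t1 t2) =
          ?k w (f t1 t2) + (\<Sum>q\<in>Q. ?k w q * var_b * psi Q s \<tau> q (f t1 t2))"
        using up.hyps fQ top1(1) top2(1) by (intro Q.psi_rec)
      also have "\<dots> = (\<Sum>p\<in>P1. \<Sum>q\<in>P2. ?k w (f p q) * d p q) +
          (\<Sum>p\<in>P1. \<Sum>q\<in>P2. ?k w (f p q) * (var_b * (X p q + Y p q)))"
      proof -
        have "?k w (f p q) * var_b * psi Q s \<tau> (f p q) (f t1 t2) =
            ?k w (f p q) * (var_b * (X p q + Y p q))" if "p \<in> P1" "q \<in> P2" for p q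
          using up.IH[OF fQ[OF that]] that by (simp add: kappa_def mult.assoc)
        then show ?thesis
          unfolding d_kappa reindex by simp
      qed
      also have "\<dots> = (\<Sum>p\<in>P1. \<Sum>q\<in>P2. ?k w (f p q) * Z p q)"
        by (simp add: Z_def sum.distrib distrib_left)
      finally show "psi Q s \<tau> w (f t1 t2) = X x y + Y x y"
        using xy by (simp add: XY_kappa)
    qed
  qed
  then show ?thesis
    using fQ assms by blast
qed

text \<open>At the pair (\<open>t1\<close>, \<open>t2\<close>) the first branch gives 0, since
  \<open>V t2 t2\<close> is 0.\<close>

theorem psi_product:
  assumes "x \<in> P1" "y \<in> P2"
  shows "psi Q s \<tau> (f x y) (f t1 t2) =
    (if x = t1 then V y t2 else if y = t2 then U x t1 else mixing (U x t1) (V y t2))"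
  using psi_product_XY[OF assms] top2(1) by (simp add: X_def Y_def mixing_eq psi_top2)

end


section \<open>Rank functions and the \<open>ab\<close>-index of a graded poset\<close>

lemma poset_bot_eq: "antisym r \<Longrightarrow> is_minimum P r m \<Longrightarrow> poset_bot P r = m"
  unfolding poset_bot_def is_minimum_def by (rule the_equality) (auto dest: antisymD)

lemma poset_top_eq: "antisym r \<Longrightarrow> is_maximum P r m \<Longrightarrow> poset_top P r = m"
  unfolding poset_top_def is_maximum_def by (rule the_equality) (auto dest: antisymD)

lemma partial_order_on_components:
  assumes "partial_order_on P r"
  shows "r \<subseteq> P \<times> P" "refl_on P r" "trans r" "antisym r"
  using assms by (simp_all add: partial_order_on_def preorder_on_def)

lemma less_in_trans:
  assumes "trans r" "antisym r"
  shows "less_in r x y \<Longrightarrow> (y, z) \<in> r \<Longrightarrow> less_in r x z"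
    and "(x, y) \<in> r \<Longrightarrow> less_in r y z \<Longrightarrow> less_in r x z"
  using assms unfolding less_in_def trans_def antisym_def by blast+

text \<open>Take a maximal element of the half-open interval that contains \<open>x\<close> but not
  \<open>y\<close>.\<close>

lemma ex_lower_cover:
  assumes fin: "finite P" and po: "partial_order_on P r" and xy: "less_in r x y"
  shows "\<exists>z. covers P r y z \<and> (x, z) \<in> r"
proof -
  note po' = partial_order_on_components[OF po] and lt_trans = less_in_trans[OF partial_order_on_components(3,4)[OF po]]
  let ?A = "{z \<in> P. (x, z) \<in> r \<and> less_in r z y}"
  have P: "x \<in> P" "y \<in> P" using xy po'(1) by (auto simp: less_in_def)
  then have "x \<in> ?A" using xy po'(2) by (auto simp: refl_on_def)
  moreover have "transp_on ?A (less_in r)" "asymp_on ?A (less_in r)"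
    using po'(4) lt_trans(1) unfolding transp_on_def asymp_on_def less_in_def antisym_def by blast+
  ultimately obtain z where z: "z \<in> ?A" "\<And>w. w \<in> ?A \<Longrightarrow> w \<noteq> z \<Longrightarrow> \<not> less_in r z w"
    using Finite_Set.bex_max_element[of ?A "less_in r"] fin by auto
  have "\<not> (less_in r z w \<and> less_in r w y)" if "w \<in> P" for w
  proof
    assume w: "less_in r z w \<and> less_in r w y"
    then have "w \<in> ?A" "w \<noteq> z"
      using that z(1) po'(3) by (auto simp: less_in_def dest: transD)
    with z(2) w show False by blast
  qed
  with z P show ?thesis by (auto simp: covers_def)
qed

lemma below_induct [consumes 3, case_names below]:
  assumes fin: "finite P" and po: "partial_order_on P r" and "x \<in> P"
    and step: "\<And>x. x \<in> P \<Longrightarrow> (\<And>y. y \<in> P \<Longrightarrow> less_in r y x \<Longrightarrow> \<Phi> y) \<Longrightarrow> \<Phi> x"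
  shows "\<Phi> x"
  using \<open>x \<in> P\<close>
proof (induction "card {w \<in> P. less_in r w x}" arbitrary: x rule: less_induct)
  case less
  note lt_trans = less_in_trans[OF partial_order_on_components(3,4)[OF po]]
  show ?case
  proof (rule step[OF less.prems])
    fix y assume y: "y \<in> P" "less_in r y x"
    moreover have "less_in r w x" if "less_in r w y" for w
      using lt_trans(1)[OF that] y(2) by (simp add: less_in_def)
    moreover have "\<not> less_in r y y"
      by (simp add: less_in_def)
    ultimately have "{w \<in> P. less_in r w y} \<subset> {w \<in> P. less_in r w x}"
      by blast
    then show "\<Phi> y"
      using y fin by (intro less.hyps psubset_card_mono) auto
  qed
qed

text \<open>Induction on \<open>y\<close>: the element \<open>x\<close> lies weakly below some lower
  cover of \<open>y\<close>, and a cover raises the rank by one.\<close>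

lemma rank_function_less:
  assumes "finite P" "partial_order_on P r" "is_rank_function P r \<rho>" "less_in r x y"
  shows "\<rho> x < \<rho> y"
proof -
  have "y \<in> P" using assms(2,4) by (auto simp: less_in_def dest: partial_order_on_components(1))
  with assms(1,2) have "\<forall>x. less_in r x y \<longrightarrow> \<rho> x < \<rho> y"
  proof (induction y rule: below_induct)
    case (below y)
    show ?case
    proof (intro allI impI)
      fix x assume "less_in r x y"
      then obtain z where z: "covers P r y z" "(x, z) \<in> r"
        using ex_lower_cover assms(1,2) by metis
      then have "\<rho> y = \<rho> z + 1" using assms(3) by (simp add: is_rank_function_def)
      moreover have "\<rho> x \<le> \<rho> z"
        using below.IH[of z] z by (cases "x = z") (auto simp: covers_def less_in_def)
      ultimately show "\<rho> x < \<rho> y" by simp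
    qed
  qed
  with assms(4) show ?thesis by blast
qed

text \<open>The minimum has rank 0, and any other element has a lower cover, which fixes its
  rank.\<close>

lemma rank_function_unique:
  assumes "finite P" "partial_order_on P r" "is_minimum P r m"
    and "is_rank_function P r \<rho>" "is_rank_function P r \<rho>'" "x \<in> P"
  shows "\<rho> x = \<rho>' x"
  using assms(1,2,6)
proof (induction x rule: below_induct)
  case (below x)
  show ?case
  proof (cases "x = m")
    case True
    then show ?thesis
      using assms poset_bot_eq[OF partial_order_on_components(4)[OF assms(2)] assms(3)]
      by (simp add: is_rank_function_def)
  next
    case False
    then have "less_in r m x" using assms(3) below.hyps by (auto simp: is_minimum_def less_in_def)
    then obtain z where z: "covers P r x z" using ex_lower_cover assms(1,2) by metis
    then have "\<rho> z = \<rho>' z" by (intro below.IH) (auto simp: covers_def)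
    with z show ?thesis using assms(4,5) by (simp add: is_rank_function_def)
  qed
qed

lemma ranked_posetI:
  assumes "finite P" "partial_order_on P r" "is_rank_function P r \<rho>"
  shows "ranked_poset P r \<rho>"
  using assms rank_function_less[OF assms] partial_order_on_components[OF assms(2)]
  by unfold_locales auto

text \<open>The flag numbers count chains by rank set, so the sum over rank sets regroups into a sum
  over chains.\<close>

lemma ab_index_eq_psi:
  assumes fin: "finite P" and po: "partial_order_on P r" and m: "is_minimum P r m"
    and t: "is_maximum P r t" and "m \<noteq> t" and \<rho>: "is_rank_function P r \<rho>"
  shows "ab_index P r = psi P r \<rho> m t"
proof -
  \<comment> \<open>The rank function chosen in the definition of \<open>flag_f\<close>; uniqueness
    exchanges it for \<open>\<rho>\<close> at the end.\<close>
  define R where "R = rank_fun P r"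
  have R: "is_rank_function P r R"
    unfolding R_def rank_fun_def by (rule someI[of _ \<rho>]) (rule \<rho>)
  note R_less = rank_function_less[OF fin po R]
  have mem: "m \<in> P" "t \<in> P" using m t by (auto simp: is_minimum_def is_maximum_def)
  have bot: "poset_bot P r = m" and top: "poset_top P r = t"
    using poset_bot_eq[OF _ m] poset_top_eq[OF _ t] partial_order_on_components(4)[OF po] by auto
  have mt: "less_in r m t"
    using m mem \<open>m \<noteq> t\<close> by (auto simp: is_minimum_def less_in_def)
  have R0: "R m = 0" using R bot by (simp add: is_rank_function_def)
  define n where "n = R t - 1"
  have n: "R t = Suc n" using R_less[OF mt] by (simp add: n_def)
  let ?O = "open_chains P r m t"
  \<comment> \<open>Ranks from 1 to \<open>n\<close> exclude \<open>m\<close>, of rank 0, and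
    \<open>t\<close>, of rank \<open>n + 1\<close>. Conversely ranks are distinct along a chain,
    which gives the cardinality.\<close>
  have fibre: "{C. C \<subseteq> P \<and> C \<in> Chains r \<and> card C = card S \<and> R ` C = S} = {C \<in> ?O. R ` C = S}"
    if S: "S \<subseteq> {1..n}" for S
  proof (intro Collect_cong iffI conjI; elim conjE CollectE)
    fix C assume C: "C \<subseteq> P" "C \<in> Chains r" "R ` C = S"
    have "less_in r m z \<and> less_in r z t" if "z \<in> C" for z
    proof -
      have "R z \<in> {1..n}" using that C(3) S by auto
      then have "z \<noteq> m" "z \<noteq> t" using R0 n by auto
      then show ?thesis
        using that C(1) m t by (auto simp: is_minimum_def is_maximum_def less_in_def)
    qed
    then show "C \<in> ?O" using C by (auto simp: open_chains_def)
  next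
    fix C assume C: "C \<in> ?O" "R ` C = S"
    have "inj_on R C"
    proof (rule inj_onI, rule ccontr)
      fix y z assume "y \<in> C" "z \<in> C" "R y = R z" "y \<noteq> z"
      with C(1) R_less[of y z] R_less[of z y] show False
        by (auto simp: open_chains_def Chains_def less_in_def)
    qed
    with C show "C \<subseteq> P" "C \<in> Chains r" "card C = card S"
      by (auto simp: open_chains_def card_image)
  qed
  have "ab_index P r = (\<Sum>S\<in>Pow {1..n}. of_nat (flag_f P r S) * chain_word S (R m) (R t))"
    unfolding ab_index_def Upsilon_def poset_rank_def top R0 var_e_def[symmetric]
    by (simp add: R_def[symmetric] n chain_word_def del: upt_Suc)
  also have "\<dots> = (\<Sum>S\<in>Pow {1..n}. \<Sum>C\<in>{C \<in> ?O. R ` C = S}. chain_word (R ` C) (R m) (R t))"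
    by (intro sum.cong refl) (simp add: flag_f_def R_def[symmetric] fibre)
  also have "\<dots> = (\<Sum>C\<in>?O. chain_word (R ` C) (R m) (R t))"
  proof (rule sum.group)
    show "finite ?O" by (rule ranked_poset.finite_open_chains[OF ranked_posetI[OF fin po R]])
    show "(`) R ` ?O \<subseteq> Pow {1..n}"
    proof (clarsimp simp: open_chains_def)
      fix C z assume "C \<subseteq> {z \<in> P. less_in r m z \<and> less_in r z t}" "z \<in> C"
      then have "R m < R z" "R z < R t" by (auto intro: R_less)
      then show "Suc 0 \<le> R z \<and> R z \<le> n" using R0 n by simp
    qed
  qed simp
  also have "\<dots> = psi P r R m t" using mt by (simp add: psi_def)
  also have "\<dots> = psi P r \<rho> m t"
    using rank_function_unique[OF fin po m R \<rho>] mem by (intro psi_cong) auto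
  finally show ?thesis .
qed


section \<open>The intervals containing an element\<close>

lemma mixing_star_bilinear: "qbilinear (\<lambda>u v. mixing (word_star u) v)"
  unfolding qbilinear_def mixing_eq
  by (intro conjI allI qlinear_plus qbilinearD1[OF qbilinear_mixing_from]
      qbilinearD2[OF qbilinear_mixing_from] qlinear_word_star qlinear_id)

lemma I2_eq: "I2 p = p + word_star p + sweedler (\<lambda>u v. mixing (word_star u) v) p"
  unfolding I2_def
  by (rule qlinear_eqI, rule qlinear_lin_ext,
      intro qlinear_plus qlinear_id qlinear_word_star qlinear_sweedler)
    (simp add: lin_ext_mon word_star_mon)

locale graded =
  fixes P :: "'a set" and r :: "'a rel" and \<rho> :: "'a \<Rightarrow> nat" and m t :: 'a
  assumes fin: "finite P" and po: "partial_order_on P r" and min: "is_minimum P r m"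
    and max: "is_maximum P r t" and nontrivial: "m \<noteq> t" and rank_fn: "is_rank_function P r \<rho>"
begin

lemmas po' = partial_order_on_components[OF po]
lemmas rank_lt = rank_function_less[OF fin po rank_fn]

sublocale ranked_poset P r \<rho>
  by (rule ranked_posetI[OF fin po rank_fn])

lemma rank_mono: "(x, y) \<in> r \<Longrightarrow> \<rho> x \<le> \<rho> y"
  using rank_lt[of x y] by (cases "x = y") (auto simp: less_in_def)

lemma mem: "m \<in> P" "t \<in> P"
  using min max by (auto simp: is_minimum_def is_maximum_def)

lemma bounds: "x \<in> P \<Longrightarrow> (m, x) \<in> r" "x \<in> P \<Longrightarrow> (x, t) \<in> r"
  using min max by (auto simp: is_minimum_def is_maximum_def)

lemma bot: "poset_bot P r = m" and top: "poset_top P r = t"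
  using poset_bot_eq[OF po'(4) min] poset_top_eq[OF po'(4) max] by auto

text \<open>Inclusion is tested at the end points, which lie in the interval as
  \<open>(y, z) \<in> r\<close>. Intervals are thus ordered as pairs with the lower end
  reversed.\<close>

lemma interval_mono_iff:
  assumes "(y, z) \<in> r"
  shows "interval P r y z \<subseteq> interval P r y' z' \<longleftrightarrow> (y', y) \<in> r \<and> (z, z') \<in> r"
proof
  assume "interval P r y z \<subseteq> interval P r y' z'"
  moreover have "y \<in> interval P r y z" "z \<in> interval P r y z"
    using assms po'(1,2) by (auto simp: interval_def refl_on_def)
  ultimately show "(y', y) \<in> r \<and> (z, z') \<in> r" by (auto simp: interval_def)
next
  assume "(y', y) \<in> r \<and> (z, z') \<in> r"
  then show "interval P r y z \<subseteq> interval P r y' z'"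
    using po'(3) unfolding interval_def trans_def by blast
qed

text \<open>Including the interval from \<open>x\<close> to \<open>x\<close> amounts to having
  \<open>x\<close> as a member, which also rules out the empty set.\<close>

lemma intervals_containing_eq:
  assumes "x \<in> P"
  shows "intervals_containing P r x =
    {interval P r y z |y z. y \<in> P \<and> z \<in> P \<and> (y, x) \<in> r \<and> (x, z) \<in> r}" (is "_ = ?R")
proof (intro equalityI subsetI)
  have xx: "(x, x) \<in> r" using assms po'(2) by (auto simp: refl_on_def)
  {
    fix I assume "I \<in> intervals_containing P r x"
    then have I: "I \<in> interval_poset P r" "interval P r x x \<subseteq> I"
      by (auto simp: intervals_containing_def interval_def[of "interval_poset P r"] relation_of_def)
    have "x \<in> I" using I(2) assms xx by (auto simp: interval_def)
    with I(1) show "I \<in> ?R" by (auto simp: interval_poset_def interval_def)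
  next
    fix I assume "I \<in> ?R"
    then obtain y z where I: "I = interval P r y z" "y \<in> P" "z \<in> P" "(y, x) \<in> r" "(x, z) \<in> r"
      by blast
    have yz: "(y, z) \<in> r" using I(4,5) po'(3) by (auto dest: transD)
    moreover have "interval P r x x \<subseteq> I" "I \<subseteq> interval P r m t"
      unfolding I(1) using I yz xx bounds by (simp_all add: interval_mono_iff)
    moreover have "I \<in> interval_poset P r" "interval P r x x \<in> interval_poset P r"
      "interval P r m t \<in> interval_poset P r"
      using I yz assms mem bounds xx by (auto simp: interval_poset_def)
    ultimately show "I \<in> intervals_containing P r x"
      by (simp add: intervals_containing_def bot top interval_def[of "interval_poset P r"]
          relation_of_def)
  }
qed

text \<open>Read off from the set itself, because a rank function receives the interval without its
  end points.\<close>

definition interval_rank :: "'a set \<Rightarrow> nat" where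
  "interval_rank I = Max (\<rho> ` I) - Min (\<rho> ` I)"

lemma interval_rank:
  assumes "(y, z) \<in> r"
  shows "interval_rank (interval P r y z) = \<rho> z - \<rho> y"
proof -
  let ?I = "interval P r y z"
  have "finite ?I" using fin by (simp add: interval_def)
  moreover have "y \<in> ?I" "z \<in> ?I"
    using assms po'(1,2) by (auto simp: interval_def refl_on_def)
  moreover have "\<rho> y \<le> \<rho> w \<and> \<rho> w \<le> \<rho> z" if "w \<in> ?I" for w
    using that by (auto simp: interval_def intro: rank_mono)
  ultimately have "Max (\<rho> ` ?I) = \<rho> z" "Min (\<rho> ` ?I) = \<rho> y"
    by (auto intro!: Max_eqI Min_eqI)
  then show ?thesis by (simp add: interval_rank_def)
qed

section \<open>The interval [[x, x], [0, 1]] as a product of two posets\<close>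

context
  fixes x assumes x: "x \<in> P"
begin

abbreviation "down \<equiv> {y \<in> P. (y, x) \<in> r}"
abbreviation "up \<equiv> {z \<in> P. (x, z) \<in> r}"
abbreviation "IC \<equiv> intervals_containing P r x"
abbreviation "IC_le \<equiv> relation_of (\<subseteq>) IC"

lemma xx: "(x, x) \<in> r"
  using x po'(2) by (auto simp: refl_on_def)

lemma down_up: "y \<in> down \<Longrightarrow> z \<in> up \<Longrightarrow> (y, z) \<in> r"
  using po'(3) by (auto dest: transD)

lemma IC_mem: "y \<in> down \<Longrightarrow> z \<in> up \<Longrightarrow> interval P r y z \<in> IC"
  by (auto simp: intervals_containing_eq[OF x])

lemma IC_cases:
  assumes "I \<in> IC"
  obtains y z where "y \<in> down" "z \<in> up" "I = interval P r y z"
  using assms by (auto simp: intervals_containing_eq[OF x])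

lemma IC_inj:
  assumes "y \<in> down" "z \<in> up" "y' \<in> down" "z' \<in> up"
  shows "interval P r y z = interval P r y' z' \<longleftrightarrow> y = y' \<and> z = z'"
  using interval_mono_iff[OF down_up[OF assms(1,2)], of y' z']
    interval_mono_iff[OF down_up[OF assms(3,4)], of y z] po'(4)
  by (auto dest: antisymD)

lemma IC_less_iff:
  assumes "y \<in> down" "z \<in> up" "y' \<in> down" "z' \<in> up"
  shows "less_in IC_le (interval P r y z) (interval P r y' z') \<longleftrightarrow>
    (y, z) \<noteq> (y', z') \<and> (y = y' \<or> less_in (r\<inverse>) y y') \<and> (z = z' \<or> less_in r z z')"
proof -
  have "(y', y) \<in> r \<longleftrightarrow> y = y' \<or> less_in (r\<inverse>) y y'" "(z, z') \<in> r \<longleftrightarrow> z = z' \<or> less_in r z z'"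
    using assms po'(2) by (auto simp: less_in_def refl_on_def)
  moreover have "less_in IC_le I J \<longleftrightarrow> I \<in> IC \<and> J \<in> IC \<and> I \<subseteq> J \<and> I \<noteq> J" for I J
    by (auto simp: less_in_def relation_of_def)
  ultimately show ?thesis
    using IC_mem[OF assms(1,2)] IC_mem[OF assms(3,4)] IC_inj[OF assms]
      interval_mono_iff[OF down_up[OF assms(1,2)], of y' z']
    by simp blast
qed

lemma IC_min: "is_minimum IC IC_le (interval P r x x)"
proof -
  have "interval P r x x \<subseteq> I" if I: "I \<in> IC" for I
    using I by (rule IC_cases) (simp add: interval_mono_iff[OF xx])
  moreover have "interval P r x x \<in> IC"
    using x xx by (intro IC_mem) auto
  ultimately show ?thesis
    by (simp add: is_minimum_def relation_of_def)
qed

lemma IC_max: "is_maximum IC IC_le (interval P r m t)"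
proof -
  have "I \<subseteq> interval P r m t" if I: "I \<in> IC" for I
    using I
  proof (rule IC_cases)
    fix y z assume yz: "y \<in> down" "z \<in> up" "I = interval P r y z"
    then show ?thesis using bounds by (simp add: interval_mono_iff[OF down_up[OF yz(1,2)]])
  qed
  moreover have "interval P r m t \<in> IC"
    using x mem bounds by (intro IC_mem) auto
  ultimately show ?thesis
    by (simp add: is_maximum_def relation_of_def)
qed

lemma IC_partial_order: "partial_order_on IC IC_le"
  by (auto simp: partial_order_on_def preorder_on_def refl_on_def relation_of_def
      intro!: transI antisymI)

lemma IC_finite: "finite IC"
  by (rule finite_subset[of _ "Pow P"])
    (auto simp: fin intervals_containing_eq[OF x] interval_def)

lemma IC_nontrivial: "interval P r x x \<noteq> interval P r m t"
  using IC_inj[of x x m t] x xx mem bounds nontrivial by auto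

text \<open>A cover of intervals moves exactly one end, and moves it along a cover of
  \<open>P\<close>.\<close>

lemma IC_rank_function: "is_rank_function IC IC_le interval_rank"
  unfolding is_rank_function_def
proof (intro conjI allI impI)
  have "antisym IC_le" using partial_order_on_components(4)[OF IC_partial_order] .
  then show "interval_rank (poset_bot IC IC_le) = 0"
    by (simp add: poset_bot_eq[OF _ IC_min] interval_rank[OF xx])
next
  fix I J assume cov: "covers IC IC_le J I"
  then obtain y z y' z' where I: "y \<in> down" "z \<in> up" "I = interval P r y z"
    and J: "y' \<in> down" "z' \<in> up" "J = interval P r y' z'"
    by (auto simp: covers_def elim!: IC_cases)
  have between: "\<not> (less_in IC_le I (interval P r u w) \<and> less_in IC_le (interval P r u w) J)"
    if "u \<in> down" "w \<in> up" for u w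
    using cov IC_mem[OF that] by (auto simp: covers_def)
  have less: "(y, z) \<noteq> (y', z')" "y = y' \<or> less_in (r\<inverse>) y y'" "z = z' \<or> less_in r z z'"
    using cov I J by (auto simp: covers_def IC_less_iff)
  have rk: "interval_rank I = \<rho> z - \<rho> y" "interval_rank J = \<rho> z' - \<rho> y'"
    "\<rho> y \<le> \<rho> z" "\<rho> y' \<le> \<rho> z'"
    using I J by (auto intro!: interval_rank rank_mono down_up simp del: mem_Collect_eq)
  \<comment> \<open>If both ends moved, the interval from \<open>y'\<close> to \<open>z\<close>
    would lie strictly between \<open>I\<close> and \<open>J\<close>.\<close>
  have "y = y' \<or> z = z'"
    using between[of y' z] less I J by (auto simp: IC_less_iff)
  then show "interval_rank J = interval_rank I + 1"
  proof
    assume y: "y = y'"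
    have "covers P r z' z"
      unfolding covers_def
    proof (intro conjI notI)
      assume "\<exists>w\<in>P. less_in r z w \<and> less_in r w z'"
      then obtain w where w: "w \<in> P" "less_in r z w" "less_in r w z'" by blast
      then have "w \<in> up" using I(2) transD[OF po'(3), of x z w] by (simp add: less_in_def)
      moreover have "z \<noteq> w" "w \<noteq> z'" using w by (auto simp: less_in_def)
      ultimately show False using between[of y w] y w I J by (auto simp: IC_less_iff)
    qed (use y less I J in auto)
    then have "\<rho> z' = \<rho> z + 1" using rank_fn by (simp add: is_rank_function_def)
    with rk y show ?thesis by simp
  next
    assume z: "z = z'"
    have "covers P r y y'"
      unfolding covers_def
    proof (intro conjI notI)
      assume "\<exists>w\<in>P. less_in r y' w \<and> less_in r w y"
      then obtain w where w: "w \<in> P" "less_in r y' w" "less_in r w y" by blast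
      then have "w \<in> down" using I(1) transD[OF po'(3), of w y x] by (simp add: less_in_def)
      moreover have "less_in (r\<inverse>) y w" "less_in (r\<inverse>) w y'" "y \<noteq> w" "w \<noteq> y'"
        using w by (auto simp: less_in_def)
      ultimately show False using between[of w z] z w I J by (auto simp: IC_less_iff)
    qed (use z less I J in \<open>auto simp: less_in_def\<close>)
    then have "\<rho> y = \<rho> y' + 1" using rank_fn by (simp add: is_rank_function_def)
    with rk z show ?thesis by simp
  qed
qed

text \<open>Lower ends form the dual of the down-set, ranked by distance from \<open>x\<close>.
  Upper ends keep their ranks in \<open>P\<close>, which start at \<open>\<rho> x\<close>; hence
  that constant.\<close>

lemma IC_product:
  "ranked_product down (r\<inverse>) (\<lambda>y. \<rho> x - \<rho> y) up r \<rho> IC IC_le interval_rank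
    (interval P r) (\<rho> x) m t"
proof (intro ranked_product.intro ranked_product_axioms.intro)
  show "ranked_poset IC IC_le interval_rank"
    by (rule ranked_posetI[OF IC_finite IC_partial_order IC_rank_function])
  show "ranked_poset up r \<rho>"
    using po' fin rank_lt by unfold_locales (auto simp: refl_on_def)
  show "ranked_poset down (r\<inverse>) (\<lambda>y. \<rho> x - \<rho> y)"
  proof
    fix y z assume yz: "y \<in> down" "z \<in> down" "less_in (r\<inverse>) y z"
    then have "\<rho> z < \<rho> y" "\<rho> y \<le> \<rho> x"
      by (auto intro: rank_lt rank_mono simp: less_in_def)
    then show "\<rho> x - \<rho> y < \<rho> x - \<rho> z" by simp
  qed (use po' fin in \<open>auto simp: refl_on_def\<close>)
  show "bij_betw (\<lambda>(y, z). interval P r y z) (down \<times> up) IC"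
    using IC_inj IC_mem by (auto simp: bij_betw_def inj_on_def elim!: IC_cases)
  show "interval_rank (interval P r y z) + \<rho> x = (\<rho> x - \<rho> y) + \<rho> z"
    if "y \<in> down" "z \<in> up" for y z
    using that rank_mono[of y x] rank_mono[of x z] interval_rank[OF down_up[OF that]] by auto
qed (use IC_less_iff mem bounds x in \<open>auto simp: less_in_def\<close>)

text \<open>The product is evaluated at the bottom pair (\<open>x\<close>, \<open>x\<close>), with
  top (\<open>m\<close>, \<open>t\<close>). The reversal comes from \<open>psi_converse\<close> with
  \<open>N = \<rho> x\<close>.\<close>

lemma ab_index_intervals_containing:
  "ab_index IC IC_le = (if x = m then psi P r \<rho> m t else if x = t then word_star (psi P r \<rho> m t)
     else mixing (word_star (psi P r \<rho> m x)) (psi P r \<rho> x t))"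
proof -
  have "psi down (r\<inverse>) (\<lambda>y. \<rho> x - \<rho> y) x m = psi P (r\<inverse>) (\<lambda>y. \<rho> x - \<rho> y) x m"
    by (rule psi_cong) (auto simp: less_in_def)
  also have "\<dots> = word_star (psi P r \<rho> m x)"
    using x mem by (intro psi_converse) auto
  finally have U: "psi down (r\<inverse>) (\<lambda>y. \<rho> x - \<rho> y) x m = word_star (psi P r \<rho> m x)" .
  have V: "psi up r \<rho> x t = psi P r \<rho> x t"
    by (rule psi_cong) (auto simp: less_in_def)
  have "ab_index IC IC_le = psi IC IC_le interval_rank (interval P r x x) (interval P r m t)"
    by (rule ab_index_eq_psi[OF IC_finite IC_partial_order IC_min IC_max IC_nontrivial IC_rank_function])
  also have "\<dots> = (if x = m then psi P r \<rho> x t else if x = t then word_star (psi P r \<rho> m x)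
      else mixing (word_star (psi P r \<rho> m x)) (psi P r \<rho> x t))"
    using x xx by (subst ranked_product.psi_product[OF IC_product]) (simp_all only: U V mem_Collect_eq simp_thms)
  finally show ?thesis by simp
qed

end

lemma total_ab_index_eq: "total_ab_index P r = I2 (ab_index P r)"
proof -
  let ?\<psi> = "psi P r \<rho>" and ?B = "\<lambda>u v. mixing (word_star u) v"
  have B0: "?B 0 v = 0" "?B u 0 = 0" for u v
    using mixing_star_bilinear unfolding qbilinear_def by (auto intro: qlinear_0)
  have \<psi>0: "?\<psi> y y = 0" for y by (simp add: psi_def less_in_def)
  \<comment> \<open>At \<open>x = m\<close> and \<open>x = t\<close> the mixing term is 0, because
    \<open>psi\<close> vanishes on equal ends. Hence it may be summed over all of \<open>P\<close>,
    as the coproduct formula requires.\<close>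
  have "total_ab_index P r = (\<Sum>x\<in>P. (if x = m then ?\<psi> m t else 0) +
      (if x = t then word_star (?\<psi> m t) else 0) + ?B (?\<psi> m x) (?\<psi> x t))"
    unfolding total_ab_index_def using nontrivial
    by (intro sum.cong refl) (auto simp: ab_index_intervals_containing B0 \<psi>0)
  also have "\<dots> = ?\<psi> m t + word_star (?\<psi> m t) + (\<Sum>x\<in>P. ?B (?\<psi> m x) (?\<psi> x t))"
    using fin mem by (simp add: sum.distrib)
  also have "\<dots> = I2 (?\<psi> m t)"
    using mem by (simp add: I2_eq sweedler_psi mixing_star_bilinear)
  also have "?\<psi> m t = ab_index P r"
    by (rule ab_index_eq_psi[OF fin po min max nontrivial rank_fn, symmetric])
  finally show ?thesis .
qed

end

theorem theorem5p7:
  fixes P :: "'a set" and r :: "'a rel" and n :: nat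
  assumes "graded_poset P r"
    and "poset_rank P r = n + 1"
  shows "total_ab_index P r = I2 (ab_index P r)"
proof -
  obtain m t where m: "is_minimum P r m" and t: "is_maximum P r t" and "finite P"
    and po: "partial_order_on P r" and ex: "\<exists>\<rho>. is_rank_function P r \<rho>"
    using assms(1) by (auto simp: graded_poset_def)
  have "is_rank_function P r (rank_fun P r)"
    unfolding rank_fun_def by (rule someI_ex[OF ex])
  \<comment> \<open>The minimum has rank 0 and the maximum has rank \<open>n + 1\<close>.\<close>
  moreover from this have "m \<noteq> t"
    using assms(2) poset_bot_eq[OF partial_order_on_components(4)[OF po] m]
      poset_top_eq[OF partial_order_on_components(4)[OF po] t]
    by (auto simp: is_rank_function_def poset_rank_def)
  ultimately have "graded P r (rank_fun P r) m t"
    using m t po \<open>finite P\<close> by (simp add: graded_def)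
  then show ?thesis by (rule graded.total_ab_index_eq)
qed

end
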